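(* For every $\tau$ with $\operatorname{Im}\tau>0$, each of the functions $e_k(\tau)$, $k=1,2,3$, solves the nonlinear differential equation of Riccati type, with coefficients in $\mathbb{C}(E_2,E_4,E_6)$, $$y'=\frac{i}{\pi}\Bigl(-y^2+\frac{\pi^2}{3}E_2(\tau)\,y+\frac{2}{9}\pi^4E_4(\tau)\Bigr),$$ where $'$ denotes $d/d\tau$.
   Context: For $\operatorname{Im}\tau>0$ let $\wp(u;1,\tau)$ be the Weierstrass $\wp$-function with period lattice $\mathbb{Z}\oplus\mathbb{Z}\tau$, i.e. $\wp(u;1,\tau)=\frac1{u^2}+\sum_{(m,n)\ne(0,0)}\left(\frac1{(u+m+n\tau)^2}-\frac1{(m+n\tau)^2}\right)$. Set $$e_1(\tau)=\wp\left(\tfrac12;1,\tau\right),\quad e_2(\tau)=\wp\left(\tfrac{1+\tau}{2};1,\tau\right),\quad e_3(\tau)=\wp\left(\tfrac{\tau}{2};1,\tau\right).$$ (Equivalently, for the lattice with periods $2\omega_1,2\omega_3$, $\tau=\omega_3/\omega_1$, $\omega_2=\omega_1+\omega_3$, the value of the $\wp$-function at $\omega_k$ is $(2\omega_1)^{-2}e_k(\tau)$.) With $\mathbf{q}=e^{2i\pi\tau}$ the normalized Eisenstein series are $$E_2=1-24\sum_{n\ge1}\sigma_1(n)\mathbf{q}^n,\quad E_4=1+240\sum_{n\ge1}\frac{n^3\mathbf{q}^n}{1-\mathbf{q}^n},\quad E_6=1-504\sum_{n\ge1}\frac{n^5\mathbf{q}^n}{1-\mathbf{q}^n},$$ where $\sigma_1(n)$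 is the sum of the positive divisors of $n$. *)

theory Defs
  imports "HOL-Analysis.Analysis"
begin

text \<open>
  The Weierstrass function with period lattice \<open>\<int> \<oplus> \<int>\<tau>\<close>. For \<open>Im \<tau> > 0\<close> the lattice series
  converges absolutely, so the unordered sum agrees with any ordered summation. Division by
  zero only occurs when \<open>u\<close> is a lattice point.
\<close>

definition weierstrass_p :: "complex \<Rightarrow> complex \<Rightarrow> complex" where
  "weierstrass_p \<tau> u =
     1 / u ^ 2 +
     (\<Sum>\<^sub>\<infinity>(m, n) \<in> UNIV - {(0 :: int, 0 :: int)}.
        1 / (u + of_int m + of_int n * \<tau>) ^ 2 - 1 / (of_int m + of_int n * \<tau>) ^ 2)"

definition weierstrass_e1 :: "complex \<Rightarrow> complex" where
  "weierstrass_e1 \<tau> = weierstrass_p \<tau> (1 / 2)"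

definition weierstrass_e2 :: "complex \<Rightarrow> complex" where
  "weierstrass_e2 \<tau> = weierstrass_p \<tau> ((1 + \<tau>) / 2)"

definition weierstrass_e3 :: "complex \<Rightarrow> complex" where
  "weierstrass_e3 \<tau> = weierstrass_p \<tau> (\<tau> / 2)"

definition nome_sq :: "complex \<Rightarrow> complex" where
  "nome_sq \<tau> = exp (2 * \<i> * complex_of_real pi * \<tau>)"

definition sigma1 :: "nat \<Rightarrow> nat" where
  "sigma1 n = (\<Sum>d | d dvd n. d)"

definition eisenstein_E2 :: "complex \<Rightarrow> complex" where
  "eisenstein_E2 \<tau> =
     1 - 24 * (\<Sum>\<^sub>\<infinity>n\<in>{1..}. of_nat (sigma1 n) * nome_sq \<tau> ^ n)"

definition eisenstein_E4 :: "complex \<Rightarrow> complex" where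
  "eisenstein_E4 \<tau> =
     1 + 240 * (\<Sum>\<^sub>\<infinity>n\<in>{1..}. of_nat n ^ 3 * nome_sq \<tau> ^ n / (1 - nome_sq \<tau> ^ n))"

definition eisenstein_E6 :: "complex \<Rightarrow> complex" where
  "eisenstein_E6 \<tau> =
     1 - 504 * (\<Sum>\<^sub>\<infinity>n\<in>{1..}. of_nat n ^ 5 * nome_sq \<tau> ^ n / (1 - nome_sq \<tau> ^ n))"

end

theory Submission
  imports Defs "HOL-Real_Asymp.Real_Asymp"
begin

text \<open>
  Write \<open>q = exp (2 \<pi> i \<tau>)\<close>, \<open>p = exp (\<pi> i \<tau>)\<close>, \<open>u\<^sub>n = q\<^sup>n / (1 - q\<^sup>n)\<close>, and
  \<open>S(q) = \<Sum> n u\<^sub>n\<close>, \<open>T(q) = \<Sum> n\<^sup>3 u\<^sub>n\<close>, so that \<open>E\<^sub>2 = P(q)\<close> and \<open>E\<^sub>4 = Q(q)\<close> with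
  \<open>P = 1 - 24 S\<close> and \<open>Q = 1 + 240 T\<close>. Let \<open>A(x) = 2 P(x\<^sup>2) - P(x)\<close>.

  Summing the lattice series row by row with the expansion
  \<open>\<Sum> 1 / (z + m)\<^sup>2 = \<pi>\<^sup>2 / sin\<^sup>2 (\<pi> z)\<close> over the integers \<open>m\<close> gives
  \<open>e\<^sub>1 = (2 \<pi>\<^sup>2 / 3) A(q)\<close>, \<open>e\<^sub>2 = -(\<pi>\<^sup>2 / 3) A(-p)\<close> and \<open>e\<^sub>3 = -(\<pi>\<^sup>2 / 3) A(p)\<close>
  (\<open>weierstrass_e1_eq\<close>, \<open>weierstrass_e2_eq\<close>, \<open>weierstrass_e3_eq\<close>).
  The claim becomes a pair of identities between power series in \<open>x\<close>:
  \<open>6 x A'(x) = -2 A(x)\<^sup>2 + P(x) A(x) + Q(x)\<close>, used at \<open>x = q\<close> for \<open>e\<^sub>1\<close>, and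
  \<open>3 x A'(x) = A(x)\<^sup>2 + P(x\<^sup>2) A(x) - 2 Q(x\<^sup>2)\<close>, used at the square roots \<open>x = \<plusminus>p\<close> of \<open>q\<close> for \<open>e\<^sub>2\<close> and
  \<open>e\<^sub>3\<close> (\<open>lambert_level_two\<close>).

  Both are consequences of one elementary identity of Liouville type (\<open>lambert_convolution\<close>), which evaluates
  \<open>\<Sum> u\<^sub>a u\<^sub>b (f \<bar>a - b\<bar> - f (a + b))\<close> over \<open>a, b \<ge> 1\<close> by the partial fraction formula
  \<open>u\<^sub>a u\<^sub>b = u\<^sub>a\<^sub>+\<^sub>b (1 + u\<^sub>a + u\<^sub>b)\<close>. The weight \<open>f k = k\<^sup>2\<close> gives Ramanujan's equation
  \<open>q P'(q) = (P(q)\<^sup>2 - Q(q)) / 12\<close>. The weight \<open>f k = (-1)\<^sup>k k\<^sup>2\<close>, combined with Ramanujan's equation at \<open>q\<close> and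
  \<open>q\<^sup>2\<close>, gives \<open>5 A(q)\<^sup>2 = Q(q) + 4 Q(q\<^sup>2)\<close>. From these the two Riccati identities follow by linear algebra.
  No theory of elliptic functions or modular forms is needed.
\<close>

section \<open>Summability of power series and their products\<close>

lemma has_sum_diff:
  fixes f g :: "'a \<Rightarrow> 'b :: real_normed_vector"
  assumes "(f has_sum s) A" "(g has_sum t) A"
  shows "((\<lambda>x. f x - g x) has_sum (s - t)) A"
  using has_sum_add[OF assms(1) has_sum_uminus[THEN iffD2], of g "- t"] assms(2) by simp

lemma summable_on_diff:
  fixes f g :: "'a \<Rightarrow> 'b :: real_normed_vector"
  assumes "f summable_on A" "g summable_on A"
  shows "(\<lambda>x. f x - g x) summable_on A"
  using has_sum_diff assms unfolding summable_on_def by blast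

lemma infsum_diff:
  fixes f g :: "'a \<Rightarrow> 'b :: real_normed_vector"
  assumes "f summable_on A" "g summable_on A"
  shows "(\<Sum>\<^sub>\<infinity>x\<in>A. f x - g x) = infsum f A - infsum g A"
  using assms by (intro infsumI has_sum_diff has_sum_infsum)

lemma summable_power_times_geometric:
  fixes x :: real
  assumes "0 \<le> x" "x < 1"
  shows "summable (\<lambda>n. real n ^ k * x ^ n)"
proof (cases "x = 0")
  case True
  show ?thesis
    by (rule summable_finite[of "{0}"]) (auto simp: True)
next
  case False
  with assms have x: "0 < x" "x < 1" by auto
  have "(\<lambda>n. real n ^ k * x ^ n) \<in> O(\<lambda>n. 1 / real n ^ 2)"
    using x by real_asymp
  moreover have "summable (\<lambda>n. norm (1 / real n ^ 2))"
    using inverse_power_summable[of 2, where 'a = real] by (simp add: inverse_eq_divide)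
  ultimately show ?thesis
    by (rule summable_comparison_test_bigo[rotated])
qed

lemma power_times_geometric_summable_on:
  fixes x :: real
  assumes "0 \<le> x" "x < 1"
  shows "(\<lambda>n. real n ^ k * x ^ n) summable_on A"
proof -
  have "(\<lambda>n. real n ^ k * x ^ n) summable_on UNIV"
    using assms summable_power_times_geometric[OF assms, of k]
    by (subst summable_on_UNIV_nonneg_real_iff) auto
  thus ?thesis using summable_on_subset_banach by blast
qed

lemma power_times_geometric_summable_on_Times:
  fixes x :: real
  assumes "0 \<le> x" "x < 1"
  shows "(\<lambda>(a, b). (real a ^ i * x ^ a) * (real b ^ j * x ^ b)) summable_on A \<times> B"
proof (rule summable_on_SigmaI)
  have s: "(\<lambda>n. real n ^ k * x ^ n) summable_on C" for k C
    by (rule power_times_geometric_summable_on[OF assms])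
  show "((\<lambda>b. case (a, b) of (a, b) \<Rightarrow> (real a ^ i * x ^ a) * (real b ^ j * x ^ b)) has_sum
          (real a ^ i * x ^ a) * (\<Sum>\<^sub>\<infinity>b\<in>B. real b ^ j * x ^ b)) B" for a
    using has_sum_cmult_right[OF has_sum_infsum[OF s[of j B]]] by simp
  show "(\<lambda>a. (real a ^ i * x ^ a) * (\<Sum>\<^sub>\<infinity>b\<in>B. real b ^ j * x ^ b)) summable_on A"
    by (intro summable_on_cmult_left s)
qed (use assms in auto)

section \<open>Lambert series and the Liouville convolution identity\<close>

text \<open>
  The coefficient \<open>u\<^sub>n = q\<^sup>n / (1 - q\<^sup>n)\<close> of a Lambert series. The value at \<open>n = 0\<close> is \<open>1 / 0 = 0\<close>.
\<close>

definition lambert_coeff :: "complex \<Rightarrow> nat \<Rightarrow> complex" where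
  "lambert_coeff q n = q ^ n / (1 - q ^ n)"

text \<open>
  The Lambert series \<open>\<Sum>n\<ge>1. n\<^sup>k q\<^sup>n / (1 - q\<^sup>n)\<close>; for odd \<open>k\<close> these are the non-constant parts of the
  Eisenstein series of weight \<open>k + 1\<close>, up to a factor.
\<close>

definition lambert_series :: "nat \<Rightarrow> complex \<Rightarrow> complex" where
  "lambert_series k q = (\<Sum>\<^sub>\<infinity>n\<in>{1..}. of_nat n ^ k * lambert_coeff q n)"

lemma one_minus_power_lower_bound:
  fixes q :: complex
  assumes "norm q < 1" "n \<ge> 1"
  shows "1 - norm q \<le> norm (1 - q ^ n)"
proof -
  have "norm q ^ n \<le> norm q ^ 1" by (rule power_decreasing) (use assms in auto)
  hence "1 - norm q \<le> norm (1::complex) - norm (q ^ n)" by (simp add: norm_power)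
  also have "\<dots> \<le> norm (1 - q ^ n)" by (rule norm_triangle_ineq2)
  finally show ?thesis .
qed

lemma one_minus_power_nonzero:
  fixes q :: complex
  assumes "norm q < 1" "n \<ge> 1"
  shows "1 - q ^ n \<noteq> 0"
  using one_minus_power_lower_bound[OF assms] assms by auto

lemma norm_lambert_coeff_le:
  assumes "norm q < 1" "n \<ge> 1"
  shows "norm (lambert_coeff q n) \<le> norm q ^ n / (1 - norm q)"
  unfolding lambert_coeff_def norm_divide norm_power
  by (intro divide_left_mono one_minus_power_lower_bound assms mult_pos_pos)
     (use assms one_minus_power_nonzero[OF assms] in auto)

text \<open>
  The two partial fraction formulas on which everything rests: a product \<open>u\<^sub>a u\<^sub>b\<close> is linear in the
  coefficients once \<open>u\<close> at the sum, respectively the difference, of the indices is factored out.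
\<close>

lemma lambert_coeff_mult:
  assumes "norm q < 1" "a \<ge> 1" "b \<ge> 1"
  shows "lambert_coeff q a * lambert_coeff q b =
           lambert_coeff q (a + b) * (1 + lambert_coeff q a + lambert_coeff q b)"
proof -
  have "1 - q ^ a \<noteq> 0" "1 - q ^ b \<noteq> 0" "1 - q ^ a * q ^ b \<noteq> 0"
    using one_minus_power_nonzero[OF assms(1), of a] one_minus_power_nonzero[OF assms(1), of b]
      one_minus_power_nonzero[OF assms(1), of "a + b"] assms by (auto simp: power_add)
  thus ?thesis unfolding lambert_coeff_def power_add
    by (simp add: divide_simps) algebra
qed

lemma lambert_coeff_mult_shift:
  assumes "norm q < 1" "b \<ge> 1" "k \<ge> 1"
  shows "lambert_coeff q b * lambert_coeff q (b + k) =
           lambert_coeff q k * (lambert_coeff q b - lambert_coeff q (b + k)) - lambert_coeff q (b + k)"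
  using lambert_coeff_mult[OF assms] by algebra

lemma lambert_coeff_abs_summable:
  assumes "norm q < 1" "\<And>n. n \<ge> 1 \<Longrightarrow> norm (f n) \<le> C * real n ^ k"
  shows "(\<lambda>n. norm (f n * lambert_coeff q n)) summable_on {1..}"
proof (rule Infinite_Sum.abs_summable_on_comparison_test')
  show "(\<lambda>n. (C / (1 - norm q)) * (real n ^ k * norm q ^ n)) summable_on {1..}"
    by (intro summable_on_cmult_right power_times_geometric_summable_on) (use assms in auto)
  fix n :: nat assume n: "n \<in> {1..}"
  have "norm (f n * lambert_coeff q n) \<le> (C * real n ^ k) * (norm q ^ n / (1 - norm q))"
    unfolding norm_mult using assms n order_trans[OF norm_ge_zero assms(2)[of n]]
    by (intro mult_mono norm_lambert_coeff_le) auto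
  thus "norm (f n * lambert_coeff q n) \<le> (C / (1 - norm q)) * (real n ^ k * norm q ^ n)"
    by (simp add: field_simps)
qed

lemma infsum_antidiagonal:
  fixes g :: "nat \<Rightarrow> nat \<Rightarrow> complex"
  assumes "(\<lambda>(a, b). g a b) summable_on {1..} \<times> {1..}"
  shows "(\<Sum>\<^sub>\<infinity>(a, b)\<in>{1..}\<times>{1..}. g a b) = (\<Sum>\<^sub>\<infinity>n\<in>{1..}. \<Sum>b\<in>{1..<n}. g (n - b) b)"
    and "(\<lambda>n. \<Sum>b\<in>{1..<n}. g (n - b) b) summable_on {1..}"
proof -
  let ?S = "Sigma {1..} (\<lambda>n. {1..<n::nat})"
  have s: "(\<lambda>(n, b). g (n - b) b) summable_on ?S"
    using assms
    by (subst summable_on_reindex_bij_witness[of _ "\<lambda>(a, b). (a + b, b)" "\<lambda>(n, b). (n - b, b)"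
          "{1..} \<times> {1..}" "\<lambda>(a, b). g a b"]) auto
  have "(\<Sum>\<^sub>\<infinity>(a, b)\<in>{1..}\<times>{1..}. g a b) = (\<Sum>\<^sub>\<infinity>(n, b)\<in>?S. g (n - b) b)"
    by (rule infsum_reindex_bij_witness[of _ "\<lambda>(n, b). (n - b, b)" "\<lambda>(a, b). (a + b, b)"]) auto
  also have "\<dots> = (\<Sum>\<^sub>\<infinity>n\<in>{1..}. \<Sum>\<^sub>\<infinity>b\<in>{1..<n}. g (n - b) b)"
    using infsum_Sigma'_banach[OF s] by simp
  finally show "(\<Sum>\<^sub>\<infinity>(a, b)\<in>{1..}\<times>{1..}. g a b) = (\<Sum>\<^sub>\<infinity>n\<in>{1..}. \<Sum>b\<in>{1..<n}. g (n - b) b)"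
    by (simp cong: infsum_cong)
  show "(\<lambda>n. \<Sum>b\<in>{1..<n}. g (n - b) b) summable_on {1..}"
    using summable_on_Sigma_banach[OF s] by (simp cong: infsum_cong)
qed

lemma geometric_bounded_summable_on_Times:
  fixes g :: "nat \<Rightarrow> nat \<Rightarrow> complex"
  assumes "0 \<le> x" "x < 1"
    and "\<And>a b. a \<ge> 1 \<Longrightarrow> b \<ge> 1 \<Longrightarrow> norm (g a b) \<le> C * ((real a ^ i * x ^ a) * (real b ^ j * x ^ b))"
  shows "(\<lambda>(a, b). g a b) summable_on {1..} \<times> {1..}"
proof (rule Infinite_Sum.abs_summable_summable, rule Infinite_Sum.abs_summable_on_comparison_test')
  show "(\<lambda>(a, b). C * ((real a ^ i * x ^ a) * (real b ^ j * x ^ b))) summable_on {1..} \<times> {1..}"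
    using summable_on_cmult_right[OF power_times_geometric_summable_on_Times[OF assms(1,2), of i j], of C]
    by (simp add: case_prod_unfold)
qed (use assms(3) in auto)

text \<open>
  The analytic form of Liouville's identity for an arbitrary weight \<open>f\<close> of at most quadratic growth.
  In the terms with \<open>f (a + b)\<close> the pairs with \<open>a + b = k\<close> contribute
  \<open>u\<^sub>k (k - 1 + 2 (u\<^sub>1 + \<dots> + u\<^sub>k\<^sub>-\<^sub>1))\<close>. In the terms with \<open>f \<bar>a - b\<bar>\<close> the pairs at distance \<open>k\<close> contribute
  twice \<open>u\<^sub>k (u\<^sub>1 + \<dots> + u\<^sub>k)\<close>, by telescoping, minus twice the tail \<open>u\<^sub>k\<^sub>+\<^sub>1 + u\<^sub>k\<^sub>+\<^sub>2 + \<dots>\<close>. The partial sums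
  \<open>u\<^sub>1 + \<dots> + u\<^sub>k\<^sub>-\<^sub>1\<close> cancel, and the tails are regrouped by Fubini. The growth bound forces \<open>f 0 = 0\<close>, so
  the diagonal \<open>a = b\<close> does not contribute.
\<close>

lemma lambert_convolution:
  fixes f :: "nat \<Rightarrow> complex"
  assumes q: "norm q < 1" and f: "\<And>k. norm (f k) \<le> real k ^ 2"
  defines "u \<equiv> lambert_coeff q"
  shows "(\<Sum>\<^sub>\<infinity>(a, b)\<in>{1..}\<times>{1..}. u a * u b * (f (if a < b then b - a else a - b) - f (a + b)))
     = (\<Sum>\<^sub>\<infinity>k\<in>{1..}. f k * (2 * u k ^ 2 - (of_nat k - 1) * u k) - 2 * u k * (\<Sum>j\<in>{1..<k}. f j))"
proof -
  let ?P = "{1..} :: nat set"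
  define r where "r = norm q"
  have r: "0 \<le> r" "r < 1" using q by (auto simp: r_def)
  define C where "C = 1 / (1 - r)"
  have C: "C \<ge> 1" using r by (auto simp: C_def field_simps)
  have u: "norm (u n) \<le> C * r ^ n" if "n \<ge> 1" for n
    using norm_lambert_coeff_le[OF q that] by (simp add: u_def r_def C_def)
  have u': "norm (u (m + n)) \<le> C * (r ^ m * r ^ n)" if "n \<ge> 1" for m n
    using u[of "m + n"] that by (simp add: power_add)
  have f0: "f 0 = 0" using f[of 0] by simp
  have u'': "norm (u (m + n)) \<le> C * r ^ m" if "m \<ge> 1" for m n
  proof -
    have "C * r ^ (m + n) \<le> C * r ^ m"
      using C r by (intro mult_left_mono power_decreasing) auto
    with u[of "m + n"] that show ?thesis by simp
  qed
  have uu: "norm (u a * u b) \<le> C ^ 2 * (r ^ a * r ^ b)" if "a \<ge> 1" "b \<ge> 1" for a b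
    using mult_mono[OF u[OF that(1)] u[OF that(2)]] C r
    by (simp add: norm_mult power2_eq_square mult_ac)
  have quad: "real (a + b) ^ 2 \<le> 4 * (real a ^ 2 * real b ^ 2)" if "a \<ge> 1" "b \<ge> 1" for a b :: nat
  proof -
    have "1 \<le> a" "1 \<le> b" using that by auto
    hence "a + b \<le> 2 * (a * b)"
      using mult_le_mono[OF \<open>1 \<le> a\<close> le_refl[of b]] mult_le_mono[OF le_refl[of a] \<open>1 \<le> b\<close>] by linarith
    hence "real (a + b) \<le> 2 * (real a * real b)"
      by (metis of_nat_le_iff of_nat_mult of_nat_numeral)
    from power_mono[OF this, of 2] show ?thesis by (simp add: power_mult_distrib)
  qed
  \<comment> \<open>all the double series converge absolutely\<close>
  have sum1: "(\<lambda>(a, b). u a * u b * f (a + b)) summable_on ?P \<times> ?P"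
  proof (rule geometric_bounded_summable_on_Times[OF r])
    fix a b :: nat assume ab: "a \<ge> 1" "b \<ge> 1"
    have "norm (u a * u b * f (a + b)) \<le> (C ^ 2 * (r ^ a * r ^ b)) * (4 * (real a ^ 2 * real b ^ 2))"
      unfolding norm_mult[of "u a * u b"]
      by (intro mult_mono uu ab order_trans[OF f quad]) (use C r in auto)
    thus "norm (u a * u b * f (a + b)) \<le> (4 * C ^ 2) * ((real a ^ 2 * r ^ a) * (real b ^ 2 * r ^ b))"
      by (simp add: mult_ac)
  qed
  have sum2: "(\<lambda>(b, k). f k * u k * u b) summable_on ?P \<times> ?P"
  proof (rule geometric_bounded_summable_on_Times[OF r])
    fix a b :: nat assume ab: "a \<ge> 1" "b \<ge> 1"
    have "norm (f b * (u b * u a)) \<le> real b ^ 2 * (C ^ 2 * (r ^ b * r ^ a))"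
      unfolding norm_mult[of "f b"] by (intro mult_mono uu ab f) (use C r in auto)
    thus "norm (f b * u b * u a) \<le> (C ^ 2) * ((real a ^ 0 * r ^ a) * (real b ^ 2 * r ^ b))"
      by (simp add: mult_ac)
  qed
  have sum3: "(\<lambda>(b, k). f k * u k * u (b + k)) summable_on ?P \<times> ?P"
  proof (rule geometric_bounded_summable_on_Times[OF r])
    fix a b :: nat assume ab: "a \<ge> 1" "b \<ge> 1"
    have "norm (f b * (u b * u (a + b))) \<le> real b ^ 2 * ((C * r ^ b) * (C * r ^ a))"
      unfolding norm_mult by (intro mult_mono u u'' ab f) (use C r in auto)
    thus "norm (f b * u b * u (a + b)) \<le> (C ^ 2) * ((real a ^ 0 * r ^ a) * (real b ^ 2 * r ^ b))"
      by (simp add: mult_ac power2_eq_square)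
  qed
  have sum4: "(\<lambda>(b, k). f k * u (b + k)) summable_on ?P \<times> ?P"
  proof (rule geometric_bounded_summable_on_Times[OF r])
    fix a b :: nat assume ab: "a \<ge> 1" "b \<ge> 1"
    have "norm (f b * u (a + b)) \<le> real b ^ 2 * (C * (r ^ a * r ^ b))"
      unfolding norm_mult by (intro mult_mono u' ab f) (use C r in auto)
    thus "norm (f b * u (a + b)) \<le> C * ((real a ^ 0 * r ^ a) * (real b ^ 2 * r ^ b))"
      by (simp add: mult_ac)
  qed
  have decomp: "u b * u (b + k) * f k = f k * u k * u b - f k * u k * u (b + k) - f k * u (b + k)"
    if "b \<ge> 1" "k \<ge> 1" for b k
    using lambert_coeff_mult_shift[OF q that] unfolding u_def by algebra
  have sum5: "(\<lambda>(b, k). u b * u (b + k) * f k) summable_on ?P \<times> ?P"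
  proof -
    have "(\<lambda>x. (\<lambda>(b, k). f k * u k * u b) x - (\<lambda>(b, k). f k * u k * u (b + k)) x
             - (\<lambda>(b, k). f k * u (b + k)) x) summable_on ?P \<times> ?P"
      by (intro summable_on_diff sum2 sum3 sum4)
    thus ?thesis by (rule summable_on_cong[THEN iffD1, rotated]) (auto simp: decomp)
  qed
  \<comment> \<open>the sum over the antidiagonals\<close>
  have sum_rev: "(\<Sum>b\<in>{1..<n}. u (n - b)) = (\<Sum>b\<in>{1..<n}. u b)" for n
    by (rule sum.reindex_bij_witness[of _ "\<lambda>b. n - b" "\<lambda>b. n - b"]) auto
  have anti: "(\<Sum>b\<in>{1..<n}. u (n - b) * u b * f (n - b + b))
      = f n * u n * (of_nat n - 1 + 2 * (\<Sum>b\<in>{1..<n}. u b))" if "n \<ge> 1" for n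
  proof -
    have "(\<Sum>b\<in>{1..<n}. u (n - b) * u b * f (n - b + b))
        = (\<Sum>b\<in>{1..<n}. f n * u n * (1 + u (n - b) + u b))"
    proof (rule sum.cong)
      fix b assume b: "b \<in> {1..<n}"
      have "1 \<le> n - b" using b by auto
      thus "u (n - b) * u b * f (n - b + b) = f n * u n * (1 + u (n - b) + u b)"
        using lambert_coeff_mult[OF q, of "n - b" b] b by (simp add: u_def)
    qed auto
    also have "\<dots> = f n * u n * (of_nat n - 1 + 2 * (\<Sum>b\<in>{1..<n}. u b))"
      using that by (simp add: sum_distrib_left[symmetric] sum.distrib sum_rev[unfolded One_nat_def] of_nat_diff)
    finally show ?thesis .
  qed
  have T1: "(\<Sum>\<^sub>\<infinity>(a, b)\<in>?P\<times>?P. u a * u b * f (a + b))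
      = (\<Sum>\<^sub>\<infinity>n\<in>?P. f n * u n * (of_nat n - 1 + 2 * (\<Sum>b\<in>{1..<n}. u b)))"
    unfolding infsum_antidiagonal(1)[OF sum1]
    by (rule infsum_cong, rule anti) auto
  have T1s: "(\<lambda>n. f n * u n * (of_nat n - 1 + 2 * (\<Sum>b\<in>{1..<n}. u b))) summable_on ?P"
    using infsum_antidiagonal(2)[OF sum1]
    by (rule summable_on_cong[THEN iffD1, rotated], intro anti) auto
  \<comment> \<open>the sum over the parallels to the diagonal\<close>
  have T4: "(\<Sum>\<^sub>\<infinity>(b, k)\<in>?P\<times>?P. f k * u (b + k)) = (\<Sum>\<^sub>\<infinity>n\<in>?P. u n * (\<Sum>j\<in>{1..<n}. f j))"
    unfolding infsum_antidiagonal(1)[OF sum4]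
    by (rule infsum_cong) (simp add: sum_distrib_left mult.commute)
  have T4s: "(\<lambda>n. u n * (\<Sum>j\<in>{1..<n}. f j)) summable_on ?P"
    using infsum_antidiagonal(2)[OF sum4]
    by (rule summable_on_cong[THEN iffD1, rotated]) (simp add: sum_distrib_left mult.commute)
  have us: "u summable_on ?P"
    using lambert_coeff_abs_summable[OF q, of "\<lambda>_. 1" 1 0]
    by (simp add: u_def Infinite_Sum.abs_summable_summable)
  have us': "u summable_on {k<..}" for k
  proof (rule summable_on_subset_banach[OF us], rule subsetI)
    fix n assume "n \<in> {k<..}"
    thus "n \<in> ?P" by simp
  qed
  have tele: "(\<Sum>\<^sub>\<infinity>b\<in>?P. u b) - (\<Sum>\<^sub>\<infinity>b\<in>?P. u (b + k)) = (\<Sum>b\<in>{1..k}. u b)" for k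
  proof -
    have "(\<Sum>\<^sub>\<infinity>b\<in>?P. u (b + k)) = (\<Sum>\<^sub>\<infinity>b\<in>{k<..}. u b)"
      by (rule infsum_reindex_bij_witness[of _ "\<lambda>b. b - k" "\<lambda>b. b + k"]) auto
    moreover have "(\<Sum>\<^sub>\<infinity>b\<in>?P. u b) = (\<Sum>\<^sub>\<infinity>b\<in>{1..k} \<union> {k<..}. u b)"
      by (rule arg_cong[of _ _ "infsum u"]) auto
    moreover have "\<dots> = (\<Sum>\<^sub>\<infinity>b\<in>{1..k}. u b) + (\<Sum>\<^sub>\<infinity>b\<in>{k<..}. u b)"
      by (rule infsum_Un_disjoint) (auto intro!: us')
    ultimately show ?thesis by simp
  qed
  have swap: "(\<Sum>\<^sub>\<infinity>(b, k)\<in>?P\<times>?P. g b k) = (\<Sum>\<^sub>\<infinity>k\<in>?P. \<Sum>\<^sub>\<infinity>b\<in>?P. g b k)"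
    "(\<lambda>k. \<Sum>\<^sub>\<infinity>b\<in>?P. g b k) summable_on ?P"
    if "(\<lambda>(b, k). g b k) summable_on ?P \<times> ?P" for g :: "nat \<Rightarrow> nat \<Rightarrow> complex"
  proof -
    have "(\<lambda>(k, b). g b k) summable_on ?P \<times> ?P"
      using that by (subst (asm) summable_on_swap) simp
    from summable_on_Sigma_banach[OF this] show "(\<lambda>k. \<Sum>\<^sub>\<infinity>b\<in>?P. g b k) summable_on ?P" by simp
    show "(\<Sum>\<^sub>\<infinity>(b, k)\<in>?P\<times>?P. g b k) = (\<Sum>\<^sub>\<infinity>k\<in>?P. \<Sum>\<^sub>\<infinity>b\<in>?P. g b k)"
      using infsum_swap_banach[OF that] infsum_Sigma'_banach[OF that] by simp
  qed
  have inner: "(\<Sum>\<^sub>\<infinity>b\<in>?P. f k * u k * u b) - (\<Sum>\<^sub>\<infinity>b\<in>?P. f k * u k * u (b + k))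
      = f k * u k * (u k + (\<Sum>b\<in>{1..<k}. u b))" if "k \<ge> 1" for k
  proof -
    have "{1..k} = insert k {1..<k}" using that by auto
    hence "(\<Sum>b\<in>{1..k}. u b) = u k + (\<Sum>b\<in>{1..<k}. u b)" by simp
    thus ?thesis unfolding infsum_cmult_right' tele[of k, symmetric] by (simp add: algebra_simps)
  qed
  have D: "(\<Sum>\<^sub>\<infinity>(b, k)\<in>?P\<times>?P. u b * u (b + k) * f k)
      = (\<Sum>\<^sub>\<infinity>k\<in>?P. f k * u k * (u k + (\<Sum>b\<in>{1..<k}. u b))) - (\<Sum>\<^sub>\<infinity>n\<in>?P. u n * (\<Sum>j\<in>{1..<n}. f j))"
    and Ds: "(\<lambda>k. f k * u k * (u k + (\<Sum>b\<in>{1..<k}. u b))) summable_on ?P"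
  proof -
    have "(\<Sum>\<^sub>\<infinity>(b, k)\<in>?P\<times>?P. u b * u (b + k) * f k)
       = (\<Sum>\<^sub>\<infinity>x\<in>?P\<times>?P. (\<lambda>(b, k). f k * u k * u b) x - (\<lambda>(b, k). f k * u k * u (b + k)) x
             - (\<lambda>(b, k). f k * u (b + k)) x)"
      by (rule infsum_cong) (auto simp: decomp)
    also have "\<dots> = (\<Sum>\<^sub>\<infinity>(b, k)\<in>?P\<times>?P. f k * u k * u b) - (\<Sum>\<^sub>\<infinity>(b, k)\<in>?P\<times>?P. f k * u k * u (b + k))
             - (\<Sum>\<^sub>\<infinity>(b, k)\<in>?P\<times>?P. f k * u (b + k))"
      by (subst infsum_diff, (intro summable_on_diff sum2 sum3 sum4)+)+ simp
    also have "(\<Sum>\<^sub>\<infinity>(b, k)\<in>?P\<times>?P. f k * u k * u b) - (\<Sum>\<^sub>\<infinity>(b, k)\<in>?P\<times>?P. f k * u k * u (b + k))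
       = (\<Sum>\<^sub>\<infinity>k\<in>?P. f k * u k * (u k + (\<Sum>b\<in>{1..<k}. u b)))"
      unfolding swap(1)[OF sum2] swap(1)[OF sum3]
        infsum_diff[OF swap(2)[OF sum2] swap(2)[OF sum3], symmetric]
      by (rule infsum_cong, rule inner) auto
    finally show "(\<Sum>\<^sub>\<infinity>(b, k)\<in>?P\<times>?P. u b * u (b + k) * f k)
      = (\<Sum>\<^sub>\<infinity>k\<in>?P. f k * u k * (u k + (\<Sum>b\<in>{1..<k}. u b))) - (\<Sum>\<^sub>\<infinity>n\<in>?P. u n * (\<Sum>j\<in>{1..<n}. f j))"
      unfolding T4 .
    show "(\<lambda>k. f k * u k * (u k + (\<Sum>b\<in>{1..<k}. u b))) summable_on ?P"
      using summable_on_diff[OF swap(2)[OF sum2] swap(2)[OF sum3]]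
      by (rule summable_on_cong[THEN iffD1, rotated], intro inner) auto
  qed
  define G where "G = (\<Sum>\<^sub>\<infinity>(b, k)\<in>?P\<times>?P. u b * u (b + k) * f k)"
  have G: "((\<lambda>(b, k). u b * u (b + k) * f k) has_sum G) (?P \<times> ?P)"
    unfolding G_def using sum5 by (rule has_sum_infsum)
  let ?g = "\<lambda>(a, b). u a * u b * f (if a < b then b - a else a - b)"
  have G1: "(?g has_sum G) {(a, b). 1 \<le> a \<and> a < b}"
    using G
    by (subst has_sum_reindex_bij_witness[of _ "\<lambda>(b, k). (b, b + k)" "\<lambda>(a, b). (a, b - a)"
          "?P \<times> ?P" "\<lambda>(b, k). u b * u (b + k) * f k" _ _ G]) auto
  have G2: "(?g has_sum G) {(a, b). 1 \<le> b \<and> b < a}"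
    using G
    by (subst has_sum_reindex_bij_witness[of _ "\<lambda>(b, k). (b + k, b)" "\<lambda>(a, b). (b, a - b)"
          "?P \<times> ?P" "\<lambda>(b, k). u b * u (b + k) * f k" _ _ G]) (auto simp: mult_ac)
  have G0: "(?g has_sum 0) {(a, b). 1 \<le> a \<and> a = b}"
    by (rule has_sum_0) (auto simp: f0)
  have "(?g has_sum (G + G + 0)) ({(a, b). 1 \<le> a \<and> a < b} \<union> {(a, b). 1 \<le> b \<and> b < a}
          \<union> {(a, b). 1 \<le> a \<and> a = b})"
    by (intro has_sum_Un_disjoint G1 G2 G0) auto
  also have "{(a, b). 1 \<le> a \<and> a < b} \<union> {(a, b). 1 \<le> b \<and> b < a} \<union> {(a, b). 1 \<le> a \<and> a = b}
     = ?P \<times> ?P" by auto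
  finally have GG: "(?g has_sum 2 * G) (?P \<times> ?P)" by simp
  have "(\<Sum>\<^sub>\<infinity>(a, b)\<in>?P\<times>?P. u a * u b * (f (if a < b then b - a else a - b) - f (a + b)))
     = (\<Sum>\<^sub>\<infinity>x\<in>?P\<times>?P. ?g x - (\<lambda>(a, b). u a * u b * f (a + b)) x)"
    by (rule infsum_cong) (auto simp: algebra_simps)
  also have "\<dots> = 2 * G - (\<Sum>\<^sub>\<infinity>n\<in>?P. f n * u n * (of_nat n - 1 + 2 * (\<Sum>b\<in>{1..<n}. u b)))"
    unfolding T1[symmetric] infsumI[OF GG, symmetric]
    by (rule infsum_diff[OF has_sum_imp_summable[OF GG] sum1])
  also have "\<dots> = (\<Sum>\<^sub>\<infinity>k\<in>?P. 2 * (f k * u k * (u k + (\<Sum>b\<in>{1..<k}. u b)))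
        - 2 * (u k * (\<Sum>j\<in>{1..<k}. f j))
        - f k * u k * (of_nat k - 1 + 2 * (\<Sum>b\<in>{1..<k}. u b)))"
    unfolding G_def D
    by (subst infsum_diff, (intro summable_on_diff summable_on_cmult_right Ds T4s T1s)+)+
       (simp add: infsum_cmult_right' right_diff_distrib)
  also have "\<dots> = (\<Sum>\<^sub>\<infinity>k\<in>?P. f k * (2 * u k ^ 2 - (of_nat k - 1) * u k) - 2 * u k * (\<Sum>j\<in>{1..<k}. f j))"
    by (rule infsum_cong) (simp add: algebra_simps power2_eq_square)
  finally show ?thesis .
qed

section \<open>Quadratic relations between Lambert series\<close>

lemma infsum_product_complex:
  fixes f g :: "nat \<Rightarrow> complex"
  assumes "(\<lambda>(a, b). f a * g b) summable_on A \<times> B"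
  shows "(\<Sum>\<^sub>\<infinity>(a, b)\<in>A\<times>B. f a * g b) = infsum f A * infsum g B"
  by (subst infsum_Sigma'_banach[OF assms, symmetric])
     (simp only: infsum_cmult_right' infsum_cmult_left')

text \<open>
  The series of \<open>q dS/dq\<close> for \<open>S = lambert_series 1\<close>, since
  \<open>q du\<^sub>n/dq = n q\<^sup>n / (1 - q\<^sup>n)\<^sup>2 = n (u\<^sub>n\<^sup>2 + u\<^sub>n)\<close>; see \<open>lambert_series_has_derivative\<close>.
\<close>

definition lambert_theta :: "complex \<Rightarrow> complex" where
  "lambert_theta q = (\<Sum>\<^sub>\<infinity>n\<in>{1..}. of_nat n ^ 2 * (lambert_coeff q n ^ 2 + lambert_coeff q n))"

lemma lambert_summable:
  assumes "norm q < 1"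
  shows "(\<lambda>n. of_nat n ^ k * lambert_coeff q n) summable_on {1..}"
  by (rule Infinite_Sum.abs_summable_summable, rule lambert_coeff_abs_summable[OF assms, of _ 1 k])
     (simp add: norm_power)

lemma lambert_theta_summable:
  assumes "norm q < 1"
  shows "(\<lambda>n. of_nat n ^ 2 * (lambert_coeff q n ^ 2 + lambert_coeff q n)) summable_on {1..}"
proof -
  define C where "C = 1 / (1 - norm q)"
  have C: "norm (lambert_coeff q n) \<le> C" if "n \<ge> 1" for n
  proof -
    have "norm q ^ n \<le> 1" using assms by (intro power_le_one) auto
    hence "norm q ^ n / (1 - norm q) \<le> C"
      unfolding C_def using assms by (intro divide_right_mono) auto
    with norm_lambert_coeff_le[OF assms that] show ?thesis by linarith
  qed
  have "(\<lambda>n. norm ((of_nat n ^ 2 * (lambert_coeff q n + 1)) * lambert_coeff q n)) summable_on {1..}"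
  proof (rule lambert_coeff_abs_summable[OF assms, of _ "C + 1" 2])
    fix n :: nat assume "n \<ge> 1"
    hence "norm (lambert_coeff q n + 1) \<le> C + 1"
      using C[of n] norm_triangle_ineq[of "lambert_coeff q n" 1] by simp
    thus "norm (of_nat n ^ 2 * (lambert_coeff q n + 1)) \<le> (C + 1) * real n ^ 2"
      by (simp add: norm_mult norm_power mult.commute[of "C + 1"] mult_left_mono)
  qed
  from Infinite_Sum.abs_summable_summable[OF this] show ?thesis
    by (simp add: algebra_simps power2_eq_square)
qed

lemma infsum_alternating:
  fixes g :: "nat \<Rightarrow> complex"
  assumes "g summable_on {1..}"
  shows "(\<Sum>\<^sub>\<infinity>n\<in>{1..}. (- 1) ^ n * g n) = 2 * (\<Sum>\<^sub>\<infinity>n\<in>{1..}. g (2 * n)) - (\<Sum>\<^sub>\<infinity>n\<in>{1..}. g n)"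
    and "(\<lambda>n. (- 1) ^ n * g n) summable_on {1..}"
proof -
  let ?E = "{n :: nat. 1 \<le> n \<and> even n}"
  have sE: "g summable_on ?E" by (rule summable_on_subset_banach[OF assms]) auto
  have "(g has_sum infsum g ?E) ?E" using sE by (rule has_sum_infsum)
  hence h: "((\<lambda>n. if even n then g n else 0) has_sum infsum g ?E) {1..}"
    by (rule has_sum_cong_neutral[THEN iffD1, rotated -1]) auto
  have e: "infsum g ?E = (\<Sum>\<^sub>\<infinity>n\<in>{1..}. g (2 * n))"
    by (rule infsum_reindex_bij_witness[of _ "\<lambda>n. 2 * n" "\<lambda>n. n div 2"]) auto
  have "((\<lambda>n. 2 * (if even n then g n else 0) - g n) has_sum (2 * infsum g ?E - infsum g {1..})) {1..}"
    by (intro has_sum_diff has_sum_cmult_right h has_sum_infsum assms)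
  also have "(\<lambda>n. 2 * (if even n then g n else 0) - g n) = (\<lambda>n. (- 1) ^ n * g n)" by auto
  finally have "((\<lambda>n. (- 1) ^ n * g n) has_sum (2 * infsum g ?E - infsum g {1..})) {1..}" .
  thus "(\<Sum>\<^sub>\<infinity>n\<in>{1..}. (- 1) ^ n * g n) = 2 * (\<Sum>\<^sub>\<infinity>n\<in>{1..}. g (2 * n)) - (\<Sum>\<^sub>\<infinity>n\<in>{1..}. g n)"
    and "(\<lambda>n. (- 1) ^ n * g n) summable_on {1..}"
    unfolding e by (rule infsumI, rule has_sum_imp_summable)
qed

lemma lambert_coeff_double: "lambert_coeff q (2 * n) = lambert_coeff (q ^ 2) n"
  unfolding lambert_coeff_def power_mult by (rule refl)

lemma infsum_alternating_lambert:
  assumes "norm q < 1"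
  shows "(\<Sum>\<^sub>\<infinity>n\<in>{1..}. (- 1) ^ n * (of_nat n ^ k * lambert_coeff q n))
           = 2 ^ (k + 1) * lambert_series k (q ^ 2) - lambert_series k q"
  unfolding infsum_alternating(1)[OF lambert_summable[OF assms]] lambert_coeff_double
  by (simp add: lambert_series_def power_mult_distrib mult.assoc infsum_cmult_right')

lemma infsum_alternating_lambert_theta:
  assumes "norm q < 1"
  shows "(\<Sum>\<^sub>\<infinity>n\<in>{1..}. (- 1) ^ n * (of_nat n ^ 2 * (lambert_coeff q n ^ 2 + lambert_coeff q n)))
           = 8 * lambert_theta (q ^ 2) - lambert_theta q"
  unfolding infsum_alternating(1)[OF lambert_theta_summable[OF assms]] lambert_coeff_double
  by (simp add: lambert_theta_def power_mult_distrib mult.assoc infsum_cmult_right')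

text \<open>
  For \<open>f k = s\<^sup>k k\<^sup>2\<close> with \<open>s = \<plusminus>1\<close> one has \<open>f \<bar>a - b\<bar> - f (a + b) = -4 (s\<^sup>a a) (s\<^sup>b b)\<close>, so that the left side of the
  convolution identity becomes a square.
\<close>

lemma lambert_square_signed:
  assumes q: "norm q < 1" and s: "s = 1 \<or> s = - 1"
  defines "f \<equiv> \<lambda>k. s ^ k * of_nat k ^ 2" and "u \<equiv> lambert_coeff q"
  shows "- 4 * (\<Sum>\<^sub>\<infinity>n\<in>{1..}. s ^ n * (of_nat n * u n)) ^ 2 =
     (\<Sum>\<^sub>\<infinity>k\<in>{1..}. f k * (2 * u k ^ 2 - (of_nat k - 1) * u k) - 2 * u k * (\<Sum>j\<in>{1..<k}. f j))"
proof -
  let ?h = "\<lambda>n. s ^ n * (of_nat n * u n)"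
  have ns: "norm s = 1" using s by auto
  have h: "norm (?h n) \<le> 1 / (1 - norm q) * (real n ^ 1 * norm q ^ n)" if "n \<ge> 1" for n
    using mult_left_mono[OF norm_lambert_coeff_le[OF q that], of "real n"]
    by (simp add: norm_mult norm_power ns u_def)
  have "norm (?h a * ?h b) \<le> (1 / (1 - norm q)) ^ 2 * ((real a ^ 1 * norm q ^ a) * (real b ^ 1 * norm q ^ b))"
    if "a \<ge> 1" "b \<ge> 1" for a b
  proof -
    have "norm (?h a * ?h b) \<le> (1 / (1 - norm q) * (real a ^ 1 * norm q ^ a))
             * (1 / (1 - norm q) * (real b ^ 1 * norm q ^ b))"
      unfolding norm_mult[of "?h a"] by (intro mult_mono h that) (use q in auto)
    thus ?thesis by (simp add: power2_eq_square mult_ac)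
  qed
  from geometric_bounded_summable_on_Times[OF _ q this]
  have sm: "(\<lambda>(a, b). ?h a * ?h b) summable_on {1..} \<times> {1..}" by simp
  have "- 4 * (\<Sum>\<^sub>\<infinity>n\<in>{1..}. ?h n) ^ 2 = - 4 * (\<Sum>\<^sub>\<infinity>(a, b)\<in>{1..}\<times>{1..}. ?h a * ?h b)"
    by (subst infsum_product_complex[OF sm]) (simp add: power2_eq_square)
  also have "\<dots> = (\<Sum>\<^sub>\<infinity>x\<in>{1..}\<times>{1..}. - 4 * (\<lambda>(a, b). ?h a * ?h b) x)"
    by (rule infsum_cmult_right'[symmetric])
  also have "\<dots> = (\<Sum>\<^sub>\<infinity>(a, b)\<in>{1..}\<times>{1..}. u a * u b * (f (if a < b then b - a else a - b) - f (a + b)))"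
  proof (rule infsum_cong)
    fix x :: "nat \<times> nat"
    obtain a b where x: "x = (a, b)" by (cases x)
    have even: "s ^ (2 * n) = 1" for n using s by (auto simp: power_mult)
    have F1: "f (if a < b then b - a else a - b) = s ^ (a + b) * (of_nat a - of_nat b) ^ 2"
    proof (cases "a < b")
      case True
      have "s ^ (a + b) = s ^ (b - a) * s ^ (2 * a)"
        using True by (simp add: power_add[symmetric])
      thus ?thesis using True by (simp add: f_def even of_nat_diff power2_commute)
    next
      case False
      have "s ^ (a + b) = s ^ (a - b) * s ^ (2 * b)"
        using False by (simp add: power_add[symmetric] add.commute)
      thus ?thesis using False by (simp add: f_def even of_nat_diff)
    qed
    have F2: "f (a + b) = s ^ (a + b) * (of_nat a + of_nat b) ^ 2"
      by (simp add: f_def)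
    show "- 4 * (\<lambda>(a, b). ?h a * ?h b) x
        = (case x of (a, b) \<Rightarrow> u a * u b * (f (if a < b then b - a else a - b) - f (a + b)))"
      unfolding x prod.case F1 F2 power_add
      by (simp add: algebra_simps power2_eq_square)
  qed
  also have "\<dots> = (\<Sum>\<^sub>\<infinity>k\<in>{1..}. f k * (2 * u k ^ 2 - (of_nat k - 1) * u k) - 2 * u k * (\<Sum>j\<in>{1..<k}. f j))"
    unfolding u_def by (rule lambert_convolution[OF q]) (simp add: f_def norm_mult norm_power ns)
  finally show ?thesis .
qed

text \<open>
  The case \<open>s = 1\<close>. With \<open>P = 1 - 24 S\<close> and \<open>Q = 1 + 240 T\<close>, where \<open>S\<close> and \<open>T\<close> are the Lambert series with
  exponents 1 and 3, it is Ramanujan's equation \<open>q dP/dq = (P\<^sup>2 - Q) / 12\<close>.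
\<close>

lemma lambert_square:
  assumes "norm q < 1"
  shows "- 4 * lambert_series 1 q ^ 2 =
           2 * lambert_theta q - 5 / 3 * lambert_series 3 q - lambert_series 1 q / 3"
proof -
  let ?u = "lambert_coeff q"
  have sq: "(\<Sum>j\<in>{1..<k}. of_nat j ^ 2) = (of_nat k - 1) * of_nat k * (2 * of_nat k - 1) / (6 :: complex)"
    if "k \<ge> 1" for k :: nat
    using that by (induction k rule: dec_induct) (auto simp: field_simps power2_eq_square)
  have "- 4 * lambert_series 1 q ^ 2 = (\<Sum>\<^sub>\<infinity>k\<in>{1..}. of_nat k ^ 2 * (2 * ?u k ^ 2 - (of_nat k - 1) * ?u k)
      - 2 * ?u k * (\<Sum>j\<in>{1..<k}. of_nat j ^ 2))"
    using lambert_square_signed[OF assms, of 1] by (simp add: lambert_series_def)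
  also have "\<dots> = (\<Sum>\<^sub>\<infinity>k\<in>{1..}. 2 * (of_nat k ^ 2 * (?u k ^ 2 + ?u k))
      - 5 / 3 * (of_nat k ^ 3 * ?u k) - 1 / 3 * (of_nat k ^ 1 * ?u k))"
    by (rule infsum_cong, subst sq) (auto simp: field_simps power2_eq_square power3_eq_cube)
  also have "\<dots> = 2 * lambert_theta q - 5 / 3 * lambert_series 3 q - 1 / 3 * lambert_series 1 q"
    unfolding lambert_theta_def lambert_series_def
    by (rule infsumI, rule has_sum_diff[OF has_sum_diff]; rule has_sum_cmult_right, rule has_sum_infsum)
       (rule lambert_summable[OF assms] lambert_theta_summable[OF assms])+
  finally show ?thesis by simp
qed

text \<open>
  The case \<open>s = -1\<close>; an alternating series is twice its even part minus the series itself, and the even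
  part is a Lambert series in \<open>q\<^sup>2\<close>.
\<close>

lemma lambert_square_alternating:
  assumes "norm q < 1"
  shows "- 4 * (4 * lambert_series 1 (q ^ 2) - lambert_series 1 q) ^ 2 =
           2 * (8 * lambert_theta (q ^ 2) - lambert_theta q)
            - (16 * lambert_series 3 (q ^ 2) - lambert_series 3 q)
            - (4 * lambert_series 1 (q ^ 2) - lambert_series 1 q)"
proof -
  let ?u = "lambert_coeff q"
  have sq: "(\<Sum>j\<in>{1..<k}. (- 1) ^ j * of_nat j ^ 2) = - ((- 1) ^ k) * of_nat k * (of_nat k - 1) / (2 :: complex)"
    if "k \<ge> 1" for k :: nat
    using that by (induction k rule: dec_induct) (auto simp: field_simps power2_eq_square)
  have "- 4 * (4 * lambert_series 1 (q ^ 2) - lambert_series 1 q) ^ 2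
      = - 4 * (\<Sum>\<^sub>\<infinity>n\<in>{1..}. (- 1) ^ n * (of_nat n * ?u n)) ^ 2"
    using infsum_alternating_lambert[OF assms, of 1] by simp
  also have "\<dots> = (\<Sum>\<^sub>\<infinity>k\<in>{1..}. (- 1) ^ k * of_nat k ^ 2 * (2 * ?u k ^ 2 - (of_nat k - 1) * ?u k)
      - 2 * ?u k * (\<Sum>j\<in>{1..<k}. (- 1) ^ j * of_nat j ^ 2))"
    using lambert_square_signed[OF assms, of "- 1"] by simp
  also have "\<dots> = (\<Sum>\<^sub>\<infinity>k\<in>{1..}. 2 * ((- 1) ^ k * (of_nat k ^ 2 * (?u k ^ 2 + ?u k)))
      - (- 1) ^ k * (of_nat k ^ 3 * ?u k) - (- 1) ^ k * (of_nat k ^ 1 * ?u k))"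
    by (rule infsum_cong, subst sq) (auto simp: field_simps power2_eq_square power3_eq_cube)
  also have "\<dots> = 2 * (8 * lambert_theta (q ^ 2) - lambert_theta q)
            - (2 ^ (3 + 1) * lambert_series 3 (q ^ 2) - lambert_series 3 q)
            - (2 ^ (1 + 1) * lambert_series 1 (q ^ 2) - lambert_series 1 q)"
    unfolding infsum_alternating_lambert[OF assms, symmetric] infsum_alternating_lambert_theta[OF assms, symmetric]
    by (rule infsumI, intro has_sum_diff has_sum_cmult_right[where c = 2])
       (rule has_sum_infsum infsum_alternating(2) lambert_summable[OF assms] lambert_theta_summable[OF assms])+
  finally show ?thesis by simp
qed

text \<open>
  The last two lemmas give three equations: Ramanujan's at \<open>q\<close> and at \<open>q\<^sup>2\<close>, and the alternating one. Eliminating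
  the derivatives \<open>E\<close> and \<open>E2\<close> from them yields
  \<open>5 A\<^sup>2 = Q(q) + 4 Q(q\<^sup>2)\<close> for \<open>A = 2 P(q\<^sup>2) - P(q)\<close>. Eliminating other terms instead yields two Riccati
  equations for \<open>A\<close>: one with coefficients \<open>P, Q\<close> at \<open>q\<close>, and one with coefficients \<open>P, Q\<close> at \<open>q\<^sup>2\<close>. In both,
  \<open>24 E - 96 E2\<close> is \<open>q dA/dq\<close>.
\<close>

lemma lambert_level_two:
  assumes "norm q < 1"
  defines "S \<equiv> lambert_series 1 q" and "S2 \<equiv> lambert_series 1 (q ^ 2)"
    and "T \<equiv> lambert_series 3 q" and "T2 \<equiv> lambert_series 3 (q ^ 2)"
    and "E \<equiv> lambert_theta q" and "E2 \<equiv> lambert_theta (q ^ 2)"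
  defines "A \<equiv> 1 + 24 * S - 48 * S2"
  shows "6 * (24 * E - 96 * E2) = - 2 * A ^ 2 + (1 - 24 * S) * A + (1 + 240 * T)"
    and "3 * (24 * E - 96 * E2) = A ^ 2 + (1 - 24 * S2) * A - 2 * (1 + 240 * T2)"
proof -
  have "norm (q ^ 2) < 1" using assms(1) by (simp add: norm_power power_less_one_iff)
  note squares = lambert_square[OF assms(1)] lambert_square[OF this] lambert_square_alternating[OF assms(1)]
  define X1 X2 X3 where X: "X1 = 2 * E - 5 / 3 * T - S / 3 + 4 * S ^ 2"
    "X2 = 2 * E2 - 5 / 3 * T2 - S2 / 3 + 4 * S2 ^ 2"
    "X3 = 2 * (8 * E2 - E) - (16 * T2 - T) - (4 * S2 - S) + 4 * (4 * S2 - S) ^ 2"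
  have zero: "X1 = 0" "X2 = 0" "X3 = 0"
    unfolding X S_def S2_def T_def T2_def E_def E2_def squares[symmetric] by simp_all
  \<comment> \<open>the combination free of \<open>E\<close> and \<open>E2\<close>\<close>
  define G where "G = X3 - 8 * X2 + X1"
  have G: "5 * A ^ 2 - ((1 + 240 * T) + 4 * (1 + 240 * T2)) = 360 * G"
    unfolding G_def X A_def by (simp add: field_simps power2_eq_square)
  have "(- 2 * A ^ 2 + (1 - 24 * S) * A + (1 + 240 * T)) - 6 * (24 * E - 96 * E2)
      = - 72 * X1 + 288 * X2 - 180 * G"
    unfolding G_def X A_def by (simp add: field_simps power2_eq_square)
  thus "6 * (24 * E - 96 * E2) = - 2 * A ^ 2 + (1 - 24 * S) * A + (1 + 240 * T)"
    by (simp add: zero G_def)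
  have "3 * (24 * E - 96 * E2) - (A ^ 2 + (1 - 24 * S2) * A - 2 * (1 + 240 * T2))
      = 36 * X1 - 144 * X2 - 90 * G"
    unfolding G_def X A_def by (simp add: field_simps power2_eq_square)
  thus "3 * (24 * E - 96 * E2) = A ^ 2 + (1 - 24 * S2) * A - 2 * (1 + 240 * T2)"
    by (simp add: zero G_def)
qed

section \<open>Other expansions and the derivative of the Lambert series\<close>

text \<open>
  Since \<open>a + b - 1 \<le> a b\<close>, the terms \<open>q\<^sup>a\<^sup>b\<close> are dominated by a product. The maximum with \<open>1 / 2\<close> keeps the
  base away from 0, as one factor of it is divided out.
\<close>

lemma norm_power_mult_le:
  fixes q :: complex
  assumes "norm q < 1" "a \<ge> 1" "b \<ge> 1"
  defines "x \<equiv> max (norm q) (1 / 2)"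
  shows "norm (q ^ (a * b)) \<le> 1 / x * (x ^ a * x ^ b)"
proof -
  have x: "x > 0" "x < 1" "norm q \<le> x" using assms(1) by (auto simp: x_def)
  obtain a' b' where ab: "a = Suc a'" "b = Suc b'"
    using assms(2,3) by (cases a; cases b) auto
  have "norm (q ^ (a * b)) \<le> x ^ (a * b)"
    unfolding norm_power by (rule power_mono) (use x in auto)
  also have "\<dots> \<le> x ^ (a' + b)"
    by (rule power_decreasing) (use x ab in auto)
  also have "\<dots> = 1 / x * (x ^ a * x ^ b)"
    using x by (simp add: ab power_add)
  finally show ?thesis .
qed

lemma divisor_double_series_summable:
  fixes q :: complex
  assumes "norm q < 1"
  shows "(\<lambda>(a, b). of_nat a * q ^ (a * b)) summable_on {1..} \<times> {1..}"
proof (rule geometric_bounded_summable_on_Times)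
  let ?x = "max (norm q) (1 / 2)"
  show "0 \<le> ?x" "?x < 1" using assms by auto
  fix a b :: nat assume "a \<ge> 1" "b \<ge> 1"
  from mult_left_mono[OF norm_power_mult_le[OF assms this], of "real a"]
  show "norm (of_nat a * q ^ (a * b)) \<le> (1 / ?x) * ((real a ^ 1 * ?x ^ a) * (real b ^ 0 * ?x ^ b))"
    by (simp add: norm_mult mult_ac)
qed

lemma lambert_series_eq_double:
  assumes "norm q < 1"
  shows "lambert_series 1 q = (\<Sum>\<^sub>\<infinity>(a, b)\<in>{1..}\<times>{1..}. of_nat a * q ^ (a * b))"
proof -
  have "(\<Sum>\<^sub>\<infinity>b\<in>{1..}. of_nat a * q ^ (a * b)) = of_nat a * lambert_coeff q a" if "a \<ge> 1" for a
  proof -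
    have "norm (q ^ a) < 1" using assms that by (simp add: norm_power power_less_one_iff)
    from has_sum_geometric_from_1[OF this]
    have "((\<lambda>b. of_nat a * q ^ (a * b)) has_sum of_nat a * lambert_coeff q a) {1..}"
      unfolding power_mult lambert_coeff_def by (rule has_sum_cmult_right)
    thus ?thesis by (rule infsumI)
  qed
  hence "lambert_series 1 q = (\<Sum>\<^sub>\<infinity>a\<in>{1..}. \<Sum>\<^sub>\<infinity>b\<in>{1..}. of_nat a * q ^ (a * b))"
    unfolding lambert_series_def by (intro infsum_cong) simp
  thus ?thesis
    using infsum_Sigma'_banach[OF divisor_double_series_summable[OF assms]] by simp
qed

lemma infsum_sigma1:
  assumes "norm q < 1"
  shows "(\<Sum>\<^sub>\<infinity>n\<in>{1..}. of_nat (sigma1 n) * q ^ n) = lambert_series 1 q"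
proof -
  let ?S = "Sigma {1..} (\<lambda>n. {d :: nat. d dvd n})"
  have s: "(\<lambda>(n, d). of_nat d * q ^ n) summable_on ?S"
    using divisor_double_series_summable[OF assms]
    by (subst summable_on_reindex_bij_witness[of _ "\<lambda>(a, b). (a * b, a)" "\<lambda>(n, d). (d, n div d)"
          "{1..} \<times> {1..}" "\<lambda>(a, b). of_nat a * q ^ (a * b)"])
       (auto simp: Suc_le_eq dvd_div_eq_0_iff intro!: Nat.gr0I)
  have "lambert_series 1 q = (\<Sum>\<^sub>\<infinity>(n, d)\<in>?S. of_nat d * q ^ n)"
    unfolding lambert_series_eq_double[OF assms]
    by (rule infsum_reindex_bij_witness[of _ "\<lambda>(n, d). (d, n div d)" "\<lambda>(a, b). (a * b, a)"])
       (auto simp: Suc_le_eq dvd_div_eq_0_iff intro!: Nat.gr0I)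
  also have "\<dots> = (\<Sum>\<^sub>\<infinity>n\<in>{1..}. \<Sum>\<^sub>\<infinity>d\<in>{d. d dvd n}. of_nat d * q ^ n)"
    by (rule infsum_Sigma'_banach[OF s, symmetric])
  also have "\<dots> = (\<Sum>\<^sub>\<infinity>n\<in>{1..}. of_nat (sigma1 n) * q ^ n)"
  proof (rule infsum_cong)
    fix n :: nat assume "n \<in> {1..}"
    hence "finite {d. d dvd n}" by (intro finite_divisors_nat) auto
    thus "(\<Sum>\<^sub>\<infinity>d\<in>{d. d dvd n}. of_nat d * q ^ n) = of_nat (sigma1 n) * q ^ n"
      by (simp add: sigma1_def sum_distrib_right)
  qed
  finally show ?thesis by simp
qed

text \<open>
  The Koebe function \<open>x / (1 - x)\<^sup>2 = \<Sum>a\<ge>1. a x\<^sup>a\<close>. With \<open>x = exp (2 \<pi> i z)\<close> it is, up to the factor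
  \<open>-4 \<pi>\<^sup>2\<close>, the sum of \<open>1 / (z + m)\<^sup>2\<close> over all integers \<open>m\<close>.
\<close>

definition koebe :: "complex \<Rightarrow> complex" where
  "koebe x = x / (1 - x) ^ 2"

lemma has_sum_koebe:
  assumes "norm x < 1"
  shows "((\<lambda>a. of_nat a * x ^ a) has_sum koebe x) {1..}"
proof -
  have "(\<lambda>n. norm (of_nat (Suc n) * x ^ n)) = (\<lambda>n. real n ^ 1 * norm x ^ n + norm x ^ n)"
    unfolding norm_mult norm_power norm_of_nat by (simp add: algebra_simps)
  moreover have "summable (\<lambda>n. real n ^ 1 * norm x ^ n + norm x ^ n)"
    using assms by (intro summable_add summable_power_times_geometric) auto
  ultimately have "((\<lambda>n. of_nat (Suc n) * x ^ n) has_sum (1 / (1 - x) ^ 2)) UNIV"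
    using geometric_deriv_sums[OF assms] by (intro norm_summable_imp_has_sum) auto
  hence "((\<lambda>n. x * (of_nat (Suc n) * x ^ n)) has_sum (x * (1 / (1 - x) ^ 2))) UNIV"
    by (rule has_sum_cmult_right)
  thus ?thesis
    by (subst (asm) has_sum_reindex_bij_witness[of _ "\<lambda>n. n - 1" Suc "{1..}" "\<lambda>a. of_nat a * x ^ a" _ _ "koebe x"])
       (auto simp: koebe_def)
qed

lemma has_sum_koebe_powers:
  assumes "norm q < 1"
  shows "((\<lambda>n. koebe (q ^ n)) has_sum lambert_series 1 q) {1..}"
proof -
  have 1: "((\<lambda>(b, a). of_nat a * q ^ (a * b)) has_sum lambert_series 1 q) ({1..} \<times> {1..})"
    using has_sum_infsum[OF divisor_double_series_summable[OF assms]]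
    unfolding lambert_series_eq_double[OF assms] by (subst has_sum_swap) simp
  show ?thesis
  proof (rule has_sum_Sigma'[OF 1])
    fix b :: nat assume "b \<in> {1..}"
    hence "norm (q ^ b) < 1" using assms by (simp add: norm_power power_less_one_iff)
    from has_sum_koebe[OF this]
    show "((\<lambda>a. case (b, a) of (b, a) \<Rightarrow> of_nat a * q ^ (a * b)) has_sum koebe (q ^ b)) {1..}"
      by (simp add: power_mult[symmetric] mult.commute)
  qed
qed

text \<open>
  \<open>q dS/dq\<close>, stated without a division by \<open>q\<close> so that \<open>q = 0\<close> needs no exception.
\<close>

lemma lambert_series_has_derivative:
  assumes "norm q < 1"
  obtains D where "(lambert_series 1 has_field_derivative D) (at q)" "q * D = lambert_theta q"
proof -
  define r where "r = (1 + norm q) / 2"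
  have r: "0 \<le> r" "0 < r" "r < 1" "norm q < r" using assms by (auto simp: r_def add_pos_nonneg)
  let ?S = "cball (0 :: complex) r"
  define f where "f n x = of_nat n * lambert_coeff x n" for n x
  define f' where "f' n x = of_nat n * (of_nat n * x ^ (n - 1) / (1 - x ^ n) ^ 2)" for n and x :: complex
  have lt: "norm x < 1" if "x \<in> ?S" for x using that r by auto
  have der: "(f n has_field_derivative f' n x) (at x within ?S)" if "x \<in> ?S" for n x
  proof (cases "n = 0")
    case True
    thus ?thesis by (simp add: f_def [abs_def] f'_def)
  next
    case False
    hence nz: "1 - x ^ n \<noteq> 0" using one_minus_power_nonzero[OF lt[OF that], of n] by auto
    show ?thesis unfolding f_def [abs_def] f'_def lambert_coeff_def
      by (rule derivative_eq_intros refl nz | use nz in \<open>simp add: field_simps power2_eq_square\<close>)+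
  qed
  have bound: "norm (f' n x) \<le> 1 / (r * (1 - r) ^ 2) * (real n ^ 2 * r ^ n)" if "x \<in> ?S" for n x
  proof (cases "n = 0")
    case False
    then obtain m where m: "n = Suc m" by (cases n) auto
    have "1 - r \<le> 1 - norm x" using that by simp
    also have "\<dots> \<le> norm (1 - x ^ n)"
      using one_minus_power_lower_bound[OF lt[OF that]] False by auto
    finally have "(1 - r) ^ 2 \<le> norm (1 - x ^ n) ^ 2" using r by (intro power_mono) auto
    moreover have "norm x ^ (n - 1) \<le> r ^ (n - 1)" using that by (intro power_mono) auto
    ultimately have "norm x ^ (n - 1) / norm (1 - x ^ n) ^ 2 \<le> r ^ (n - 1) / (1 - r) ^ 2"
      using r by (intro frac_le) auto
    hence "real n ^ 2 * (norm x ^ (n - 1) / norm (1 - x ^ n) ^ 2) \<le> real n ^ 2 * (r ^ (n - 1) / (1 - r) ^ 2)"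
      by (intro mult_left_mono) auto
    moreover have "norm (f' n x) = real n ^ 2 * (norm x ^ (n - 1) / norm (1 - x ^ n) ^ 2)"
      unfolding f'_def norm_mult norm_divide norm_power norm_of_nat by (simp add: power2_eq_square)
    moreover have "real n ^ 2 * (r ^ (n - 1) / (1 - r) ^ 2) = 1 / (r * (1 - r) ^ 2) * (real n ^ 2 * r ^ n)"
      using r by (simp add: m)
    ultimately show ?thesis by simp
  qed (simp add: f'_def)
  have unif: "uniformly_convergent_on ?S (\<lambda>n x. \<Sum>i<n. f' i x)"
    by (rule Weierstrass_m_test'[OF bound]) (use r in \<open>auto intro!: summable_mult summable_power_times_geometric\<close>)
  have suminf: "(\<Sum>n. g n) = infsum g {1..}" if "g summable_on {1..}" "g 0 = 0" for g :: "nat \<Rightarrow> complex"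
  proof -
    have "(g has_sum infsum g {1..}) {1..}" using that(1) by (rule has_sum_infsum)
    hence "(g has_sum infsum g {1..}) UNIV"
      by (rule has_sum_cong_neutral[THEN iffD1, rotated -1]) (use that(2) in \<open>auto simp: not_le\<close>)
    thus ?thesis using has_sum_imp_sums sums_unique by metis
  qed
  have f0: "f n 0 = 0" for n by (cases n) (simp_all add: f_def lambert_coeff_def)
  have "((\<lambda>x. \<Sum>n. f n x) has_field_derivative (\<Sum>n. f' n q)) (at q)"
    by (rule has_field_derivative_series'(2)[OF _ der unif, of 0])
       (use r f0 in \<open>auto simp: interior_cball\<close>)
  moreover have "(\<Sum>n. f n x) = lambert_series 1 x" if "x \<in> ball 0 1" for x
    using suminf[of "\<lambda>n. f n x"] lambert_summable[of x 1] that
    by (simp add: f_def lambert_series_def)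
  ultimately have "(lambert_series 1 has_field_derivative (\<Sum>n. f' n q)) (at q)"
    using assms by (elim has_field_derivative_transform_within_open[of _ _ _ "ball 0 1"]) auto
  moreover have "q * (\<Sum>n. f' n q) = lambert_theta q"
  proof -
    have "summable (\<lambda>n. f' n q)"
    proof (rule summable_comparison_test'[of _ 0])
      show "summable (\<lambda>n. 1 / (r * (1 - r) ^ 2) * (real n ^ 2 * r ^ n))"
        by (intro summable_mult summable_power_times_geometric) (use r in auto)
      show "norm (f' n q) \<le> 1 / (r * (1 - r) ^ 2) * (real n ^ 2 * r ^ n)" for n
        by (rule bound) (use r in auto)
    qed
    hence "q * (\<Sum>n. f' n q) = (\<Sum>n. q * f' n q)" by (rule suminf_mult[symmetric])
    also have "(\<lambda>n. q * f' n q) = (\<lambda>n. of_nat n ^ 2 * (lambert_coeff q n ^ 2 + lambert_coeff q n))"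
    proof
      fix n show "q * f' n q = of_nat n ^ 2 * (lambert_coeff q n ^ 2 + lambert_coeff q n)"
      proof (cases n)
        case (Suc m)
        hence nz: "1 - q ^ n \<noteq> 0" using one_minus_power_nonzero[OF assms, of n] by auto
        have "(1 - d) / d ^ 2 = ((1 - d) / d) ^ 2 + (1 - d) / d" if "d \<noteq> 0" for d :: complex
          using that by (simp add: field_simps power2_eq_square)
        from this[OF nz] have "q ^ n / (1 - q ^ n) ^ 2 = (q ^ n / (1 - q ^ n)) ^ 2 + q ^ n / (1 - q ^ n)"
          by simp
        moreover have "q * f' n q = of_nat n ^ 2 * (q ^ n / (1 - q ^ n) ^ 2)"
          by (simp add: f'_def Suc power2_eq_square)
        ultimately show ?thesis by (simp add: lambert_coeff_def)
      qed (simp add: f'_def)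
    qed
    also have "(\<Sum>n. of_nat n ^ 2 * (lambert_coeff q n ^ 2 + lambert_coeff q n)) = lambert_theta q"
      unfolding lambert_theta_def by (rule suminf[OF lambert_theta_summable[OF assms]]) simp
    finally show ?thesis .
  qed
  ultimately show ?thesis by (rule that)
qed

section \<open>The partial fraction expansion of the inverse squared sine\<close>

lemma has_sum_int:
  fixes f :: "int \<Rightarrow> 'a :: {topological_comm_monoid_add}"
  assumes "((\<lambda>n. f (int n)) has_sum a) UNIV" "((\<lambda>n. f (- int n - 1)) has_sum b) UNIV"
  shows "(f has_sum (a + b)) UNIV"
proof -
  have "(f has_sum a) {0..}"
    using assms(1)
    by (subst has_sum_reindex_bij_witness[of _ int nat UNIV "\<lambda>n. f (int n)" f _ a]) auto
  moreover have "(f has_sum b) {..<0}"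
    using assms(2)
    by (subst has_sum_reindex_bij_witness[of _ "\<lambda>n. - int n - 1" "\<lambda>n. nat (- n - 1)" UNIV
          "\<lambda>n. f (- int n - 1)" f _ b]) auto
  ultimately have "(f has_sum (a + b)) ({0..} \<union> {..<0})"
    by (rule has_sum_Un_disjoint) auto
  also have "{0..} \<union> {..<0} = (UNIV :: int set)" by auto
  finally show ?thesis .
qed

lemma norm_inverse_square_summable:
  fixes z :: complex
  shows "summable (\<lambda>n. norm (inverse ((z + of_nat n) ^ Suc 1)))"
proof -
  have "eventually (\<lambda>n. norm (inverse ((z + of_nat n) ^ Suc 1)) \<le> 4 * (1 / real n ^ 2)) sequentially"
    using eventually_gt_at_top[of "nat \<lceil>2 * norm z\<rceil>"]
  proof eventually_elim
    case (elim n)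
    hence n: "real n > 2 * norm z" "real n > 0"
      by (linarith, metis elim gr_implies_not0 of_nat_0_less_iff zero_less_iff_neq_zero)
    have "norm (of_nat n :: complex) - norm z \<le> norm (z + of_nat n)"
      by (metis add.commute norm_diff_ineq)
    hence "real n / 2 \<le> norm (z + of_nat n)" using n by simp
    hence "(real n / 2) ^ 2 \<le> norm (z + of_nat n) ^ 2" using n by (intro power_mono) auto
    hence "1 / norm (z + of_nat n) ^ 2 \<le> 1 / (real n / 2) ^ 2"
      using n by (intro divide_left_mono mult_pos_pos) (auto intro: zero_less_power order_less_le_trans)
    thus ?case
      by (simp add: norm_inverse norm_power norm_mult power2_eq_square inverse_eq_divide norm_divide)
  qed
  moreover have "summable (\<lambda>n. 4 * (1 / real n ^ 2))"
    using inverse_power_summable[of 2, where 'a = real]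
    by (intro summable_mult) (simp add: inverse_eq_divide)
  ultimately show ?thesis
    by (intro summable_comparison_test_ev[of "\<lambda>n. norm (inverse ((z + of_nat n) ^ Suc 1))"]) auto
qed

text \<open>
  The logarithmic derivative of Euler's reflection formula; a second differentiation gives
  \<open>Trigamma_reflection\<close>, and the series of the trigamma function then gives the expansion of
  \<open>\<pi>\<^sup>2 / sin\<^sup>2 (\<pi> z)\<close>.
\<close>

lemma Digamma_reflection:
  fixes z :: complex
  assumes "z \<notin> \<int>"
  shows "Digamma z - Digamma (1 - z) = - of_real pi * cot (of_real pi * z)"
proof -
  have nz: "z \<notin> \<int>\<^sub>\<le>\<^sub>0" "1 - z \<notin> \<int>\<^sub>\<le>\<^sub>0"
    using assms nonpos_Ints_subset_Ints Ints_diff[OF Ints_1, of "1 - z"] by auto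
  have s: "sin (of_real pi * z) \<noteq> 0"
    using Gamma_reflection_complex[of z] Gamma_nonzero[OF nz(1)] Gamma_nonzero[OF nz(2)] by auto
  have "((\<lambda>z. Gamma z * Gamma (1 - z) * sin (of_real pi * z)) has_field_derivative
      (Gamma z * Digamma z * Gamma (1 - z) - Gamma z * (Gamma (1 - z) * Digamma (1 - z))) * sin (of_real pi * z)
      + Gamma z * Gamma (1 - z) * (of_real pi * cos (of_real pi * z))) (at z)"
    by (rule derivative_eq_intros refl nz | simp add: algebra_simps)+
  moreover have "((\<lambda>z. Gamma z * Gamma (1 - z) * sin (of_real pi * z)) has_field_derivative 0) (at z)"
  proof (rule has_field_derivative_transform_within_open[of "\<lambda>_. of_real pi" _ _ "- \<int>"])
    fix w :: complex assume "w \<in> - \<int>"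
    hence w: "w \<notin> \<int>\<^sub>\<le>\<^sub>0" "1 - w \<notin> \<int>\<^sub>\<le>\<^sub>0"
      using nonpos_Ints_subset_Ints Ints_diff[OF Ints_1, of "1 - w"] by auto
    have "sin (of_real pi * w) \<noteq> 0"
      using Gamma_reflection_complex[of w] Gamma_nonzero[OF w(1)] Gamma_nonzero[OF w(2)] by auto
    thus "of_real pi = Gamma w * Gamma (1 - w) * sin (of_real pi * w)"
      by (simp add: Gamma_reflection_complex)
  qed (use assms in \<open>auto simp: open_Compl closed_Ints\<close>)
  ultimately have "(Gamma z * Digamma z * Gamma (1 - z) - Gamma z * (Gamma (1 - z) * Digamma (1 - z))) * sin (of_real pi * z)
      + Gamma z * Gamma (1 - z) * (of_real pi * cos (of_real pi * z)) = 0"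
    by (rule DERIV_unique)
  hence "(Gamma z * Gamma (1 - z)) * ((Digamma z - Digamma (1 - z)) * sin (of_real pi * z) + of_real pi * cos (of_real pi * z)) = 0"
    by (simp add: algebra_simps)
  hence "(Digamma z - Digamma (1 - z)) * sin (of_real pi * z) + of_real pi * cos (of_real pi * z) = 0"
    using Gamma_nonzero[OF nz(1)] Gamma_nonzero[OF nz(2)] by simp
  thus ?thesis using s by (simp add: cot_def field_simps add_eq_0_iff)
qed

lemma Trigamma_reflection:
  fixes z :: complex
  assumes "z \<notin> \<int>"
  shows "Polygamma 1 z + Polygamma 1 (1 - z) = of_real pi ^ 2 / sin (of_real pi * z) ^ 2"
proof -
  have nz: "z \<notin> \<int>\<^sub>\<le>\<^sub>0" "1 - z \<notin> \<int>\<^sub>\<le>\<^sub>0"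
    using assms nonpos_Ints_subset_Ints Ints_diff[OF Ints_1, of "1 - z"] by auto
  have s: "sin (of_real pi * z) \<noteq> 0"
    using Gamma_reflection_complex[of z] Gamma_nonzero[OF nz(1)] Gamma_nonzero[OF nz(2)] by auto
  have "((\<lambda>z. Digamma z - Digamma (1 - z)) has_field_derivative (Polygamma 1 z + Polygamma 1 (1 - z))) (at z)"
    by (rule derivative_eq_intros refl nz | simp)+
  moreover have "((\<lambda>z. Digamma z - Digamma (1 - z)) has_field_derivative
      (of_real pi ^ 2 / sin (of_real pi * z) ^ 2)) (at z)"
  proof (rule has_field_derivative_transform_within_open[of "\<lambda>z. - of_real pi * cot (of_real pi * z)" _ _ "- \<int>"])
    show "((\<lambda>z. - of_real pi * cot (of_real pi * z)) has_field_derivative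
      (of_real pi ^ 2 / sin (of_real pi * z) ^ 2)) (at z)"
      using s by (auto intro!: derivative_eq_intros DERIV_chain2[OF DERIV_cot]
                       simp: power2_eq_square inverse_eq_divide)
  qed (use assms in \<open>auto simp: open_Compl closed_Ints Digamma_reflection\<close>)
  ultimately show ?thesis by (rule DERIV_unique)
qed

lemma has_sum_inverse_square_shifts:
  fixes z :: complex
  assumes "z \<notin> \<int>"
  shows "((\<lambda>m :: int. 1 / (z + of_int m) ^ 2) has_sum of_real pi ^ 2 / sin (of_real pi * z) ^ 2) UNIV"
proof -
  have 1: "((\<lambda>n. inverse ((z + of_nat n) ^ Suc 1)) has_sum Polygamma 1 z) UNIV" if "z \<noteq> 0" for z :: complex
    using Polygamma_LIMSEQ[OF that, of 1]
    by (intro norm_summable_imp_has_sum norm_inverse_square_summable) simp_all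
  have "z \<noteq> 0" "1 - z \<noteq> 0" using assms by auto
  note 2 = 1[OF this(1)] 1[OF this(2)]
  have "((\<lambda>m :: int. 1 / (z + of_int m) ^ 2) has_sum (Polygamma 1 z + Polygamma 1 (1 - z))) UNIV"
  proof (rule has_sum_int)
    show "((\<lambda>n. 1 / (z + of_int (int n)) ^ 2) has_sum Polygamma 1 z) UNIV"
      using 2(1) by (simp add: power2_eq_square inverse_eq_divide)
    have "1 / (z + of_int (- int n - 1)) ^ 2 = inverse ((1 - z + of_nat n) ^ Suc 1)" for n
      by (simp add: inverse_eq_divide power2_eq_square algebra_simps)
    thus "((\<lambda>n. 1 / (z + of_int (- int n - 1)) ^ 2) has_sum Polygamma 1 (1 - z)) UNIV"
      using 2(2) by simp
  qed
  thus ?thesis by (simp only: Trigamma_reflection[OF assms])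
qed

lemma pi_sin_eq_koebe:
  "of_real pi ^ 2 / sin (of_real pi * z) ^ 2 = - 4 * of_real pi ^ 2 * koebe (exp (2 * \<i> * of_real pi * z))"
proof -
  define v where "v = exp (\<i> * (of_real pi * z))"
  have v: "v \<noteq> 0" by (simp add: v_def)
  have w: "exp (2 * \<i> * of_real pi * z) = v ^ 2"
    by (simp add: v_def exp_of_nat_mult[symmetric] mult_ac flip: exp_double)
  have "sin (of_real pi * z) = (v - inverse v) / (2 * \<i>)"
    by (simp add: sin_exp_eq v_def exp_minus mult_ac)
  hence "sin (of_real pi * z) ^ 2 = - ((v - inverse v) ^ 2 / 4)"
    by (simp add: power_divide power_mult_distrib)
  also have "(v - inverse v) ^ 2 = (1 - v ^ 2) ^ 2 / v ^ 2"
    using v by (simp add: field_simps power2_eq_square)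
  finally show ?thesis unfolding w koebe_def by simp
qed

lemma koebe_inverse: "koebe (inverse x) = koebe x"
proof (cases "x = 0 \<or> x = 1")
  case False
  hence "(1 - inverse x) ^ 2 = (1 - x) ^ 2 / x ^ 2"
    by (simp add: field_simps power2_eq_square)
  thus ?thesis using False by (simp add: koebe_def power2_eq_square field_simps)
qed (auto simp: koebe_def)

section \<open>Absolute convergence of the lattice series at half periods\<close>

lemma has_sum_int_symmetric:
  fixes f :: "int \<Rightarrow> 'a :: {topological_comm_monoid_add}"
  assumes "((\<lambda>n. f (int n)) has_sum a) {1..}" "((\<lambda>n. f (- int n)) has_sum b) {1..}"
  shows "(f has_sum (f 0 + a + b)) UNIV"
proof -
  have "(f has_sum f 0) {0}" by (rule has_sum_finiteI) auto
  moreover have "(f has_sum a) {1..}"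
    using assms(1)
    by (subst has_sum_reindex_bij_witness[of _ int nat "{1..}" "\<lambda>n. f (int n)" f _ a]) auto
  moreover have "(f has_sum b) {..-1}"
    using assms(2)
    by (subst has_sum_reindex_bij_witness[of _ "\<lambda>n. - int n" "\<lambda>n. nat (- n)" "{1..}"
          "\<lambda>n. f (- int n)" f _ b]) auto
  ultimately have "(f has_sum (f 0 + a + b)) ({0} \<union> {1..} \<union> {..-1})"
    by (intro has_sum_Un_disjoint) auto
  also have "{0} \<union> {1..} \<union> {..-1} = (UNIV :: int set)" by auto
  finally show ?thesis .
qed

lemma int_powr_summable_on: "(\<lambda>m :: int. (1 + \<bar>real_of_int m\<bar>) powr (- 3 / 2)) summable_on UNIV"
proof -
  have "summable (\<lambda>n. real (Suc n) powr (- 3 / 2))"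
    using summable_real_powr_iff[of "- 3 / 2"] by (subst summable_Suc_iff) simp
  hence "(\<lambda>n. real (Suc n) powr (- 3 / 2)) summable_on UNIV"
    by (subst summable_on_UNIV_nonneg_real_iff) auto
  hence 1: "((\<lambda>n. (1 + real n) powr (- 3 / 2)) has_sum (\<Sum>\<^sub>\<infinity>n. (1 + real n) powr (- 3 / 2))) UNIV"
    by (intro has_sum_infsum) simp
  hence "(\<lambda>n. (1 + real n) powr (- 3 / 2)) summable_on {1..}"
    using summable_on_subset_banach[OF has_sum_imp_summable[OF 1]] by blast
  hence 2: "((\<lambda>n. (1 + real n) powr (- 3 / 2)) has_sum (\<Sum>\<^sub>\<infinity>n\<in>{1..}. (1 + real n) powr (- 3 / 2))) {1..}"
    by (rule has_sum_infsum)
  show ?thesis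
    by (rule has_sum_imp_summable, rule has_sum_int_symmetric) (use 2 in simp_all)
qed

lemma lattice_norm_lower_bound:
  assumes "Im \<tau> > 0"
  obtains K where "K > 0"
    "\<And>m n :: int. \<bar>real_of_int m\<bar> + \<bar>real_of_int n\<bar> \<le> K * norm (of_int m + of_int n * \<tau>)"
proof -
  define K where "K = 1 + (norm \<tau> + 1) / Im \<tau>"
  have "\<bar>real_of_int m\<bar> + \<bar>real_of_int n\<bar> \<le> K * norm (of_int m + of_int n * \<tau>)" for m n :: int
  proof -
    define z where "z = of_int m + of_int n * \<tau>"
    have "\<bar>real_of_int n\<bar> * Im \<tau> = \<bar>Im z\<bar>" using assms by (simp add: z_def abs_mult)
    also have "\<dots> \<le> norm z" by (rule abs_Im_le_cmod)
    finally have n: "\<bar>real_of_int n\<bar> \<le> norm z / Im \<tau>" using assms by (simp add: field_simps)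
    have "norm (of_int m :: complex) = norm (z - of_int n * \<tau>)" by (simp add: z_def)
    also have "\<dots> \<le> norm z + norm (of_int n * \<tau>)" by (rule norm_triangle_ineq4)
    finally have "\<bar>real_of_int m\<bar> \<le> norm z + \<bar>real_of_int n\<bar> * norm \<tau>" by (simp add: norm_mult)
    also have "\<dots> \<le> norm z + norm z / Im \<tau> * norm \<tau>"
      by (intro add_left_mono mult_right_mono n) auto
    finally have "\<bar>real_of_int m\<bar> + \<bar>real_of_int n\<bar> \<le> norm z + norm z / Im \<tau> * norm \<tau> + norm z / Im \<tau>"
      using n by linarith
    also have "\<dots> = K * norm z" by (simp add: K_def field_simps add_divide_distrib)
    finally show ?thesis by (simp add: z_def)
  qed
  moreover have "K > 0" using assms by (simp add: K_def add_pos_nonneg)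
  ultimately show ?thesis using that by blast
qed

lemma inverse_cube_le:
  fixes a b :: real
  assumes "a \<ge> 0" "b \<ge> 0" "a + b \<ge> 1"
  shows "1 / (a + b) ^ 3 \<le> 8 * ((1 + a) powr (- 3 / 2) * (1 + b) powr (- 3 / 2))"
proof -
  define x where "x = 1 + a + b"
  have x: "x > 0" using assms by (simp add: x_def)
  have "1 / (a + b) ^ 3 \<le> 1 / (x / 2) ^ 3"
    unfolding x_def using assms by (intro divide_left_mono power_mono mult_pos_pos zero_less_power) auto
  also have "\<dots> = 8 * x powr (- 3)"
  proof -
    have "x powr (- 3) = 1 / x ^ 3" using x powr_numeral[of x "num.Bit1 num.One"]
      by (simp add: powr_minus_divide)
    thus ?thesis by (simp add: power_divide)
  qed
  also have "x powr (- 3) = (x powr 2) powr (- 3 / 2)"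
    by (simp add: powr_powr)
  also have "x powr 2 = x ^ 2" using x by (intro powr_numeral) auto
  also have "(x ^ 2) powr (- 3 / 2) \<le> ((1 + a) * (1 + b)) powr (- 3 / 2)"
  proof (rule powr_mono2')
    have "0 \<le> a * b" using assms by simp
    moreover have "x ^ 2 = (1 + a) * (1 + b) + (a + b + a * b + a ^ 2 + b ^ 2)"
      by (simp add: x_def power2_eq_square algebra_simps)
    ultimately show "(1 + a) * (1 + b) \<le> x ^ 2"
      using assms by simp
  qed (use assms in auto)
  also have "\<dots> = (1 + a) powr (- 3 / 2) * (1 + b) powr (- 3 / 2)"
    using assms by (subst powr_mult) auto
  finally show ?thesis by simp
qed

text \<open>
  The half periods are \<open>(j + k \<tau>) / 2\<close> with \<open>j, k \<in> {0, 1}\<close>, not both 0.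
\<close>

lemma half_period_not_lattice:
  fixes j k :: int
  assumes "Im \<tau> > 0" "j \<in> {0, 1}" "k \<in> {0, 1}" "(j, k) \<noteq> (0, 0)"
  shows "(of_int j + of_int k * \<tau>) / 2 + of_int n * \<tau> \<notin> \<int>"
proof
  assume "(of_int j + of_int k * \<tau>) / 2 + of_int n * \<tau> \<in> \<int>"
  then obtain l where l: "(of_int j + of_int k * \<tau>) / 2 + of_int n * \<tau> = of_int l"
    by (elim Ints_cases)
  hence "of_int j + of_int (k + 2 * n) * \<tau> = of_int (2 * l)"
    by (simp add: field_simps)
  from arg_cong[OF this, of Im] arg_cong[OF this, of Re]
  have "real_of_int (k + 2 * n) = 0" "real_of_int j = real_of_int (2 * l)"
    using assms(1) by auto
  hence "k + 2 * n = 0" "j = 2 * l" by linarith+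
  thus False using assms(2-4) by auto presburger+
qed

text \<open>
  At a half period \<open>u\<close> both \<open>w = m + n \<tau>\<close> and \<open>u + w = ((2 m + j) + (2 n + k) \<tau>) / 2\<close> have modulus at least a
  constant times \<open>\<bar>m\<bar> + \<bar>n\<bar>\<close>. So the summand is of order \<open>(\<bar>m\<bar> + \<bar>n\<bar>)\<^sup>-\<^sup>3\<close>, and this is dominated by the product of
  \<open>(1 + \<bar>m\<bar>)\<close> and \<open>(1 + \<bar>n\<bar>)\<close>, each to the power \<open>-3/2\<close>.
\<close>

lemma weierstrass_p_summable:
  fixes j k :: int
  assumes "Im \<tau> > 0" "j \<in> {0, 1}" "k \<in> {0, 1}" "(j, k) \<noteq> (0, 0)"
  defines "u \<equiv> (of_int j + of_int k * \<tau>) / 2"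
  shows "(\<lambda>(m :: int, n :: int). 1 / (u + of_int m + of_int n * \<tau>) ^ 2 - 1 / (of_int m + of_int n * \<tau>) ^ 2)
           summable_on UNIV - {(0, 0)}"
proof -
  obtain K where K: "K > 0"
    "\<And>m n :: int. \<bar>real_of_int m\<bar> + \<bar>real_of_int n\<bar> \<le> K * norm (of_int m + of_int n * \<tau>)"
    using lattice_norm_lower_bound[OF assms(1)] by blast
  define C where "C = norm u * (1 / ((1 / K) * (1 / (2 * K)) ^ 2) + 1 / ((1 / K) ^ 2 * (1 / (2 * K))))"
  define h where "h = (\<lambda>m :: int. (1 + \<bar>real_of_int m\<bar>) powr (- 3 / 2))"
  have hs: "h summable_on UNIV" unfolding h_def by (rule int_powr_summable_on)
  have "(\<lambda>(m, n). h m * h n) summable_on UNIV \<times> UNIV"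
  proof (rule summable_on_SigmaI)
    show "((\<lambda>n. case (m, n) of (m, n) \<Rightarrow> h m * h n) has_sum h m * infsum h UNIV) UNIV" for m
      using has_sum_cmult_right[OF has_sum_infsum[OF hs]] by simp
    show "(\<lambda>m. h m * infsum h UNIV) summable_on UNIV" by (intro summable_on_cmult_left hs)
  qed (auto simp: h_def)
  hence "(\<lambda>(m, n). h m * h n) summable_on UNIV - {(0, 0)}"
    by (rule summable_on_subset_banach) auto
  from summable_on_cmult_right[OF this, of "C * 8"]
  have hh: "(\<lambda>(m, n). C * (8 * (h m * h n))) summable_on UNIV - {(0, 0)}"
    by (simp add: case_prod_unfold mult.assoc)
  show ?thesis
  proof (rule Infinite_Sum.abs_summable_summable, rule Infinite_Sum.abs_summable_on_comparison_test'[OF hh])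
    fix x :: "int \<times> int" assume x: "x \<in> UNIV - {(0, 0)}"
    obtain m n where mn: "x = (m, n)" by (cases x)
    define N where "N = \<bar>real_of_int m\<bar> + \<bar>real_of_int n\<bar>"
    have N: "N \<ge> 1" using x by (auto simp: N_def mn)
    define w where "w = of_int m + of_int n * \<tau>"
    have w: "N / K \<le> norm w" using K(1) K(2)[of m n] by (simp add: w_def N_def field_simps)
    have "\<bar>m\<bar> + \<bar>n\<bar> \<le> \<bar>2 * m + j\<bar> + \<bar>2 * n + k\<bar>"
      using assms(2,3) by auto
    hence "N \<le> \<bar>real_of_int (2 * m + j)\<bar> + \<bar>real_of_int (2 * n + k)\<bar>"
      unfolding N_def of_int_abs[symmetric] of_int_add[symmetric] of_int_le_iff .
    also have "\<dots> \<le> K * norm (of_int (2 * m + j) + of_int (2 * n + k) * \<tau>)" by (rule K(2))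
    also have "of_int (2 * m + j) + of_int (2 * n + k) * \<tau> = 2 * (u + w)"
      by (simp add: u_def w_def field_simps)
    also have "norm (2 * (u + w)) = 2 * norm (u + w)" by (simp only: norm_mult norm_numeral)
    finally have uw: "N / (2 * K) \<le> norm (u + w)" using K(1) by (simp add: field_simps)
    have pos: "0 < N / K" "0 < N / (2 * K)" using N K(1) by auto
    have nz: "w \<noteq> 0" "u + w \<noteq> 0" using w uw pos by auto
    have "1 / b ^ 2 - 1 / a ^ 2 = - ((b - a) * (1 / (a * b ^ 2) + 1 / (a ^ 2 * b)))"
      if "a \<noteq> 0" "b \<noteq> 0" for a b :: complex
      using that by (simp add: field_simps power2_eq_square)
    from this[OF nz]
    have "1 / (u + w) ^ 2 - 1 / w ^ 2 = - (u * (1 / (w * (u + w) ^ 2) + 1 / (w ^ 2 * (u + w))))"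
      by simp
    hence "norm (1 / (u + w) ^ 2 - 1 / w ^ 2)
        = norm u * norm (1 / (w * (u + w) ^ 2) + 1 / (w ^ 2 * (u + w)))"
      by (simp add: norm_mult)
    also have "\<dots> \<le> norm u * (norm (1 / (w * (u + w) ^ 2)) + norm (1 / (w ^ 2 * (u + w))))"
      by (intro mult_left_mono norm_triangle_ineq) auto
    also have "\<dots> = norm u * (1 / (norm w * norm (u + w) ^ 2) + 1 / (norm w ^ 2 * norm (u + w)))"
      by (simp add: norm_divide norm_mult norm_power)
    also have "\<dots> \<le> norm u * (1 / ((N / K) * (N / (2 * K)) ^ 2) + 1 / ((N / K) ^ 2 * (N / (2 * K))))"
      by (intro mult_left_mono add_mono divide_left_mono mult_mono power_mono w uw
            mult_pos_pos zero_less_power) (use pos nz in auto)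
    also have "\<dots> = C * (1 / N ^ 3)"
    proof -
      have "1 / ((N * p) * (N * r) ^ 2) + 1 / ((N * p) ^ 2 * (N * r))
          = (1 / (p * r ^ 2) + 1 / (p ^ 2 * r)) * (1 / N ^ 3)" for p r :: real
        by (simp add: add_divide_distrib power2_eq_square power3_eq_cube mult_ac)
      from this[of "1 / K" "1 / (2 * K)"] show ?thesis by (simp add: C_def mult.assoc)
    qed
    also have "\<dots> \<le> C * (8 * (h m * h n))"
    proof (rule mult_left_mono)
      show "1 / N ^ 3 \<le> 8 * (h m * h n)"
        unfolding N_def h_def by (rule inverse_cube_le) (use N in \<open>auto simp: N_def\<close>)
    qed (use K(1) in \<open>auto simp: C_def\<close>)
    finally show "norm (case x of (m, n) \<Rightarrow> 1 / (u + of_int m + of_int n * \<tau>) ^ 2 - 1 / (of_int m + of_int n * \<tau>) ^ 2)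
        \<le> (case x of (m, n) \<Rightarrow> C * (8 * (h m * h n)))"
      by (simp add: mn w_def add.assoc)
  qed
qed

section \<open>The Weierstrass function at half periods as a Lambert series\<close>

text \<open>
  The term \<open>m = 0\<close> is \<open>1 / 0 = 0\<close>, so this is twice the Basel sum.
\<close>

lemma has_sum_inverse_squares_int:
  "((\<lambda>m :: int. 1 / of_int m ^ 2) has_sum of_real pi ^ 2 / (3 :: complex)) UNIV"
proof -
  have "summable (\<lambda>n. norm (1 / real (n + 1) ^ 2))"
    using inverse_squares_sums by (simp add: sums_iff)
  hence "((\<lambda>n. 1 / real (n + 1) ^ 2) has_sum pi ^ 2 / 6) UNIV"
    using inverse_squares_sums by (intro norm_summable_imp_has_sum) (simp_all add: add.commute)
  hence "((\<lambda>n. 1 / real n ^ 2) has_sum pi ^ 2 / 6) {1..}"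
    by (subst has_sum_reindex_bij_witness[of _ "\<lambda>n. n + 1" "\<lambda>n. n - 1" UNIV "\<lambda>n. 1 / real (n + 1) ^ 2" _ _ "pi ^ 2 / 6"]) auto
  from has_sum_of_real[OF this, where 'a = complex]
  have h: "((\<lambda>n. 1 / of_nat n ^ 2) has_sum (of_real pi ^ 2 / 6 :: complex)) {1..}" by simp
  have "((\<lambda>m :: int. 1 / of_int m ^ 2) has_sum 1 / of_int 0 ^ 2 + of_real pi ^ 2 / 6 + of_real pi ^ 2 / (6 :: complex)) UNIV"
    by (rule has_sum_int_symmetric) (use h in simp_all)
  thus ?thesis by simp
qed

text \<open>
  The lattice sum taken row by row, each row being evaluated by the expansion of the inverse squared sine.
\<close>

lemma weierstrass_p_has_sum_rows:
  fixes j k :: int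
  assumes "Im \<tau> > 0" "j \<in> {0, 1}" "k \<in> {0, 1}" "(j, k) \<noteq> (0, 0)"
  defines "u \<equiv> (of_int j + of_int k * \<tau>) / 2"
  defines "e \<equiv> \<lambda>z. exp (2 * \<i> * of_real pi * z)"
  shows "((\<lambda>n :: int. if n = 0 then - 4 * of_real pi ^ 2 * koebe (e u) - of_real pi ^ 2 / 3
            else - 4 * of_real pi ^ 2 * (koebe (e (u + of_int n * \<tau>)) - koebe (e (of_int n * \<tau>))))
          has_sum weierstrass_p \<tau> u) UNIV"
proof -
  let ?g = "\<lambda>(m :: int, n :: int). 1 / (u + of_int m + of_int n * \<tau>) ^ 2 - 1 / (of_int m + of_int n * \<tau>) ^ 2"
  have "?g summable_on UNIV - {(0, 0)}"
    unfolding u_def by (rule weierstrass_p_summable[OF assms(1-4)])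
  hence "(?g has_sum (\<Sum>\<^sub>\<infinity>x\<in>UNIV - {(0, 0)}. ?g x)) (UNIV - {(0, 0)})"
    by (rule has_sum_infsum)
  \<comment> \<open>at \<open>(0, 0)\<close> the subtracted term is \<open>1 / 0 = 0\<close>, so the summand is the polar term\<close>
  moreover have "(?g has_sum 1 / u ^ 2) {(0, 0)}"
    by (rule has_sum_finiteI) auto
  ultimately have "(?g has_sum (1 / u ^ 2 + (\<Sum>\<^sub>\<infinity>x\<in>UNIV - {(0, 0)}. ?g x))) ({(0, 0)} \<union> (UNIV - {(0, 0)}))"
    by (intro has_sum_Un_disjoint) auto
  hence "(?g has_sum weierstrass_p \<tau> u) (UNIV \<times> UNIV)"
    by (simp add: weierstrass_p_def)
  hence total: "((\<lambda>(n, m). ?g (m, n)) has_sum weierstrass_p \<tau> u) (UNIV \<times> UNIV)"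
    by (subst (asm) has_sum_swap) simp
  have shifts: "((\<lambda>m. 1 / (z + of_int m) ^ 2) has_sum - 4 * of_real pi ^ 2 * koebe (e z)) UNIV" if "z \<notin> \<int>" for z
    using has_sum_inverse_square_shifts[OF that] by (simp only: pi_sin_eq_koebe e_def)
  show ?thesis
  proof (rule has_sum_Sigma'[OF total])
    fix n :: int
    have u: "u + of_int n * \<tau> \<notin> \<int>" for n
      unfolding u_def by (rule half_period_not_lattice[OF assms(1-4)])
    show "((\<lambda>m. case (n, m) of (n, m) \<Rightarrow> ?g (m, n)) has_sum
       (if n = 0 then - 4 * of_real pi ^ 2 * koebe (e u) - of_real pi ^ 2 / 3
            else - 4 * of_real pi ^ 2 * (koebe (e (u + of_int n * \<tau>)) - koebe (e (of_int n * \<tau>))))) UNIV"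
    proof (cases "n = 0")
      case True
      have "u \<notin> \<int>" using u[of 0] by simp
      from has_sum_diff[OF shifts[OF this] has_sum_inverse_squares_int] True show ?thesis by simp
    next
      case False
      have "of_int n * \<tau> \<notin> \<int>"
      proof
        assume "of_int n * \<tau> \<in> \<int>"
        then obtain l where "of_int n * \<tau> = of_int l" by (elim Ints_cases)
        from arg_cong[OF this, of Im] show False using assms(1) False by simp
      qed
      from has_sum_diff[OF shifts[OF u[of n]] shifts[OF this]] False show ?thesis
        by (simp add: algebra_simps)
    qed
  qed
qed

text \<open>
  The Eisenstein series \<open>2 P(x\<^sup>2) - P(x)\<close> of weight 2 and level 2, where \<open>P(x) = 1 - 24 S(x)\<close>.
\<close>

definition level_two_E2 :: "complex \<Rightarrow> complex" where
  "level_two_E2 x = 1 + 24 * lambert_series 1 x - 48 * lambert_series 1 (x ^ 2)"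

lemma has_sum_koebe_even_powers:
  assumes "norm x < 1"
  shows "((\<lambda>n. koebe (x ^ (2 * n))) has_sum lambert_series 1 (x ^ 2)) {1..}"
proof -
  have "norm (x ^ 2) < 1" using assms by (simp add: norm_power power_less_one_iff)
  from has_sum_koebe_powers[OF this] show ?thesis unfolding power_mult .
qed

lemma has_sum_koebe_odd_powers:
  assumes "norm x < 1"
  shows "((\<lambda>n. koebe (x ^ (2 * n - 1))) has_sum lambert_series 1 x - lambert_series 1 (x ^ 2)) {1..}"
    and "((\<lambda>n. koebe (x ^ (2 * n + 1))) has_sum
            lambert_series 1 x - lambert_series 1 (x ^ 2) - koebe x) {1..}"
proof -
  let ?E = "{n :: nat. 1 \<le> n \<and> even n}"
  let ?d = "lambert_series 1 x - lambert_series 1 (x ^ 2)"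
  have "((\<lambda>n. koebe (x ^ n)) has_sum lambert_series 1 (x ^ 2)) ?E"
    using has_sum_koebe_even_powers[OF assms]
    by (subst has_sum_reindex_bij_witness[of _ "\<lambda>n. 2 * n" "\<lambda>n. n div 2" "{1..}"
          "\<lambda>n. koebe (x ^ (2 * n))" _ _ "lambert_series 1 (x ^ 2)"]) auto
  from has_sum_Diff[OF has_sum_koebe_powers[OF assms] this]
  have odd: "((\<lambda>n. koebe (x ^ n)) has_sum ?d) ({1..} - ?E)" by (simp add: subset_iff)
  thus "((\<lambda>n. koebe (x ^ (2 * n - 1))) has_sum ?d) {1..}"
    by (subst has_sum_reindex_bij_witness[of _ "\<lambda>n. (n + 1) div 2" "\<lambda>n. 2 * n - 1" "{1..} - ?E"
          "\<lambda>n. koebe (x ^ n)" _ _ ?d]) (auto elim!: oddE)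
  have "((\<lambda>n. koebe (x ^ n)) has_sum koebe x) {1}"
    by (rule has_sum_finiteI) auto
  from has_sum_Diff[OF odd this]
  have "((\<lambda>n. koebe (x ^ n)) has_sum (?d - koebe x)) ({1..} - ?E - {1})" by auto
  thus "((\<lambda>n. koebe (x ^ (2 * n + 1))) has_sum (?d - koebe x)) {1..}"
    by (subst has_sum_reindex_bij_witness[of _ "\<lambda>n. n div 2" "\<lambda>n. 2 * n + 1" "{1..} - ?E - {1}"
          "\<lambda>n. koebe (x ^ n)" _ _ "?d - koebe x"]) (auto elim!: oddE)
qed

lemma nome_sq_eq_square: "nome_sq \<tau> = exp (\<i> * of_real pi * \<tau>) ^ 2"
  unfolding nome_sq_def exp_double[symmetric] by (simp only: mult.assoc)

lemma norm_nome_sq_less_1: "Im \<tau> > 0 \<Longrightarrow> norm (nome_sq \<tau>) < 1"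
  by (simp add: nome_sq_def)

lemma exp_lattice_shift:
  "exp (2 * \<i> * of_real pi * (u + of_int (int n) * \<tau>)) = exp (2 * \<i> * of_real pi * u) * nome_sq \<tau> ^ n"
  "exp (2 * \<i> * of_real pi * (u + of_int (- int n) * \<tau>)) = exp (2 * \<i> * of_real pi * u) / nome_sq \<tau> ^ n"
proof -
  have 1: "2 * \<i> * of_real pi * (u + of_int (int n) * \<tau>)
      = 2 * \<i> * of_real pi * u + of_nat n * (2 * \<i> * of_real pi * \<tau>)"
    by (simp add: algebra_simps)
  have 2: "2 * \<i> * of_real pi * (u + of_int (- int n) * \<tau>)
      = 2 * \<i> * of_real pi * u - of_nat n * (2 * \<i> * of_real pi * \<tau>)"
    by (simp add: algebra_simps)
  show "exp (2 * \<i> * of_real pi * (u + of_int (int n) * \<tau>)) = exp (2 * \<i> * of_real pi * u) * nome_sq \<tau> ^ n"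
    unfolding 1 nome_sq_def exp_add exp_of_nat_mult ..
  show "exp (2 * \<i> * of_real pi * (u + of_int (- int n) * \<tau>)) = exp (2 * \<i> * of_real pi * u) / nome_sq \<tau> ^ n"
    unfolding 2 nome_sq_def exp_diff exp_of_nat_mult ..
qed

text \<open>
  Rows \<open>n\<close> and \<open>-n\<close> are collected in the sums \<open>a\<close> and \<open>b\<close>; the symmetry of \<open>koebe\<close> under inversion removes
  negative powers of \<open>q\<close>.
\<close>

lemma weierstrass_p_half_period:
  fixes j k :: int
  assumes \<tau>: "Im \<tau> > 0" and jk: "j \<in> {0, 1}" "k \<in> {0, 1}" "(j, k) \<noteq> (0, 0)"
  defines "u \<equiv> (of_int j + of_int k * \<tau>) / 2"
  defines "w \<equiv> exp (2 * \<i> * of_real pi * u)" and "q \<equiv> nome_sq \<tau>"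
  assumes a: "((\<lambda>n. koebe (w * q ^ n) - koebe (q ^ n)) has_sum a) {1..}"
    and b: "((\<lambda>n. koebe (w / q ^ n) - koebe (q ^ n)) has_sum b) {1..}"
  shows "weierstrass_p \<tau> u = - 4 * of_real pi ^ 2 * (koebe w + a + b) - of_real pi ^ 2 / 3"
proof -
  let ?c = "- 4 * of_real pi ^ 2 :: complex"
  let ?F = "\<lambda>n :: int. if n = 0 then ?c * koebe w - of_real pi ^ 2 / 3
            else ?c * (koebe (exp (2 * \<i> * of_real pi * (u + of_int n * \<tau>)))
                       - koebe (exp (2 * \<i> * of_real pi * (of_int n * \<tau>))))"
  have "((\<lambda>n. ?F (int n)) has_sum ?c * a) {1..}"
  proof (rule has_sum_cong[THEN iffD1, OF _ has_sum_cmult_right[OF a]])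
    fix n :: nat assume "n \<in> {1..}"
    thus "?c * (koebe (w * q ^ n) - koebe (q ^ n)) = ?F (int n)"
      using exp_lattice_shift(1)[of u n \<tau>] exp_lattice_shift(1)[of 0 n \<tau>]
      by (simp add: w_def q_def)
  qed
  moreover have "((\<lambda>n. ?F (- int n)) has_sum ?c * b) {1..}"
  proof (rule has_sum_cong[THEN iffD1, OF _ has_sum_cmult_right[OF b]])
    fix n :: nat assume "n \<in> {1..}"
    moreover have "koebe (exp (2 * \<i> * of_real pi * (of_int (- int n) * \<tau>))) = koebe (q ^ n)"
      using exp_lattice_shift(2)[of 0 n \<tau>] koebe_inverse[of "q ^ n"]
      by (simp add: q_def inverse_eq_divide)
    ultimately show "?c * (koebe (w / q ^ n) - koebe (q ^ n)) = ?F (- int n)"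
      using exp_lattice_shift(2)[of u n \<tau>]
      by (simp add: w_def q_def)
  qed
  ultimately have F: "(?F has_sum ?F 0 + ?c * a + ?c * b) UNIV" by (rule has_sum_int_symmetric)
  have "(?F has_sum weierstrass_p \<tau> u) UNIV"
    unfolding w_def u_def by (rule weierstrass_p_has_sum_rows[OF \<tau> jk])
  from has_sum_unique[OF this F] have "weierstrass_p \<tau> u = ?F 0 + ?c * a + ?c * b" .
  thus ?thesis by (simp add: algebra_simps)
qed

text \<open>
  The half periods \<open>\<tau> / 2\<close> and \<open>(1 + \<tau>) / 2\<close> together: in both cases \<open>w\<^sup>2 = q\<close>, so the rows give the values of
  \<open>koebe\<close> at odd powers of \<open>w\<close>, with the values at even powers subtracted.
\<close>

lemma weierstrass_p_half_period_odd:
  fixes j :: int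
  assumes \<tau>: "Im \<tau> > 0" and j: "j \<in> {0, 1}"
  defines "u \<equiv> (of_int j + \<tau>) / 2"
  defines "w \<equiv> exp (2 * \<i> * of_real pi * u)"
  shows "weierstrass_p \<tau> u = - (of_real pi ^ 2 / 3) * level_two_E2 w"
proof -
  have w2: "nome_sq \<tau> = w ^ 2"
  proof -
    have "2 * (2 * \<i> * of_real pi * u) = 2 * \<i> * of_real pi * of_int j + 2 * \<i> * of_real pi * \<tau>"
      by (simp add: u_def algebra_simps)
    hence "w ^ 2 = exp (2 * \<i> * of_real pi * of_int j + 2 * \<i> * of_real pi * \<tau>)"
      by (simp only: w_def exp_double[symmetric])
    also have "\<dots> = exp (2 * \<i> * of_real pi * of_int j) * nome_sq \<tau>"
      by (simp add: exp_add nome_sq_def)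
    also have "exp (2 * \<i> * of_real pi * of_int j) = 1"
      using j exp_two_pi_i' by (auto simp: mult_ac)
    finally show ?thesis by simp
  qed
  have "norm (w ^ 2) < 1" using norm_nome_sq_less_1[OF \<tau>] by (simp add: w2)
  hence w: "norm w < 1" by (simp add: norm_power power_less_one_iff)
  have w0: "w \<noteq> 0" by (simp add: w_def)
  let ?S = "lambert_series 1 w" and ?S2 = "lambert_series 1 (w ^ 2)"
  have pow: "w * w ^ (2 * n) = w ^ (2 * n + 1)" "(w ^ 2) ^ n = w ^ (2 * n)" for n
    by (simp, rule power_mult[symmetric])
  have a: "((\<lambda>n. koebe (w * nome_sq \<tau> ^ n) - koebe (nome_sq \<tau> ^ n)) has_sum (?S - ?S2 - koebe w) - ?S2) {1..}"
    using has_sum_diff[OF has_sum_koebe_odd_powers(2)[OF w] has_sum_koebe_even_powers[OF w]]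
    unfolding w2 pow .
  have "koebe (w / (w ^ 2) ^ n) = koebe (w ^ (2 * n - 1))" if "n \<ge> 1" for n
  proof -
    have "2 * n = Suc (2 * n - 1)" using that by simp
    hence "w ^ (2 * n) = w * w ^ (2 * n - 1)" by (metis power_Suc)
    hence "(w ^ 2) ^ n = w * w ^ (2 * n - 1)" by (simp only: pow)
    hence "w / (w ^ 2) ^ n = inverse (w ^ (2 * n - 1))"
      using w0 by (simp add: inverse_eq_divide)
    thus ?thesis by (simp add: koebe_inverse)
  qed
  hence b: "((\<lambda>n. koebe (w / nome_sq \<tau> ^ n) - koebe (nome_sq \<tau> ^ n)) has_sum (?S - ?S2) - ?S2) {1..}"
    using has_sum_diff[OF has_sum_koebe_odd_powers(1)[OF w] has_sum_koebe_even_powers[OF w]]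
    by (elim has_sum_cong[THEN iffD1, rotated]) (simp add: w2 pow(2))
  have "(j, 1) \<noteq> (0, 0 :: int)" by simp
  from weierstrass_p_half_period[OF \<tau> j _ this, of "(?S - ?S2 - koebe w) - ?S2" "(?S - ?S2) - ?S2"] a b
  have "weierstrass_p \<tau> u = - 4 * of_real pi ^ 2 *
      (koebe w + ((?S - ?S2 - koebe w) - ?S2) + ((?S - ?S2) - ?S2)) - of_real pi ^ 2 / 3"
    by (simp add: u_def w_def)
  thus ?thesis by (simp add: level_two_E2_def field_simps)
qed

lemma koebe_uminus: "x ^ 2 \<noteq> 1 \<Longrightarrow> koebe (- x) = 4 * koebe (x ^ 2) - koebe x"
proof -
  assume "x ^ 2 \<noteq> 1"
  hence "1 + x \<noteq> 0" "1 - x \<noteq> 0" by (auto simp: power2_eq_square add_eq_0_iff)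
  define y where "y = 1 + x"
  define z where "z = 1 - x"
  have "1 - x ^ 2 = y * z" "4 * x = y ^ 2 - z ^ 2"
    by (auto simp: y_def z_def power2_eq_square algebra_simps)
  have "- x / y ^ 2 = 4 * x ^ 2 / (y * z) ^ 2 - x / z ^ 2"
  proof -
    have "4 * x ^ 2 / (y * z) ^ 2 = x * (4 * x) / (y ^ 2 * z ^ 2)"
      by (simp add: power_mult_distrib power2_eq_square mult_ac)
    also have "\<dots> = x / z ^ 2 - x / y ^ 2"
      using \<open>1 + x \<noteq> 0\<close> \<open>1 - x \<noteq> 0\<close> unfolding \<open>4 * x = y ^ 2 - z ^ 2\<close>
      by (simp add: y_def[symmetric] z_def[symmetric] right_diff_distrib diff_divide_distrib)
    finally show ?thesis by simp
  qed
  thus ?thesis unfolding koebe_def \<open>1 - x ^ 2 = y * z\<close> by (simp add: y_def z_def)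
qed

lemma weierstrass_e1_eq:
  assumes \<tau>: "Im \<tau> > 0"
  shows "weierstrass_e1 \<tau> = 2 * of_real pi ^ 2 / 3 * level_two_E2 (nome_sq \<tau>)"
proof -
  define q where "q = nome_sq \<tau>"
  have q: "norm q < 1" using norm_nome_sq_less_1[OF \<tau>] by (simp add: q_def)
  let ?S = "lambert_series 1 q" and ?S2 = "lambert_series 1 (q ^ 2)"
  have w: "exp (2 * \<i> * of_real pi * ((of_int 1 + of_int 0 * \<tau>) / 2)) = - 1"
    using exp_pi_i by (simp add: mult_ac)
  have neg: "koebe (- (q ^ n)) = 4 * koebe (q ^ (2 * n)) - koebe (q ^ n)" if "n \<ge> 1" for n
  proof -
    have "q ^ (n * 2) \<noteq> 1" using one_minus_power_nonzero[OF q, of "n * 2"] that by auto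
    thus ?thesis using koebe_uminus[of "q ^ n"]
      unfolding power_mult[symmetric] mult.commute[of n 2] by simp
  qed
  have "((\<lambda>n. 4 * koebe (q ^ (2 * n)) - koebe (q ^ n) - koebe (q ^ n)) has_sum 4 * ?S2 - ?S - ?S) {1..}"
    by (intro has_sum_diff has_sum_cmult_right has_sum_koebe_even_powers has_sum_koebe_powers q)
  hence a: "((\<lambda>n. koebe (- 1 * q ^ n) - koebe (q ^ n)) has_sum 4 * ?S2 - ?S - ?S) {1..}"
    by (elim has_sum_cong[THEN iffD1, rotated]) (simp add: neg)
  have "koebe (- 1 / q ^ n) = koebe (- 1 * q ^ n)" for n
    using koebe_inverse[of "- (q ^ n)"] by (simp add: inverse_eq_divide)
  with a have b: "((\<lambda>n. koebe (- 1 / q ^ n) - koebe (q ^ n)) has_sum 4 * ?S2 - ?S - ?S) {1..}"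
    by simp
  have "weierstrass_p \<tau> (1 / 2) = - 4 * of_real pi ^ 2 * (koebe (- 1) + (4 * ?S2 - ?S - ?S) + (4 * ?S2 - ?S - ?S))
          - of_real pi ^ 2 / 3"
    using weierstrass_p_half_period[OF \<tau>, of 1 0, unfolded w, folded q_def, OF _ _ _ a b] by simp
  moreover have "koebe (- 1) = - 1 / 4" by (simp add: koebe_def)
  ultimately show ?thesis
    unfolding weierstrass_e1_def level_two_E2_def q_def by (simp add: algebra_simps)
qed

lemma weierstrass_e2_eq:
  assumes "Im \<tau> > 0"
  shows "weierstrass_e2 \<tau> = - (of_real pi ^ 2 / 3) * level_two_E2 (- exp (\<i> * of_real pi * \<tau>))"
proof -
  have "2 * \<i> * of_real pi * ((1 + \<tau>) / 2) = \<i> * of_real pi + \<i> * of_real pi * \<tau>"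
    by (simp add: field_simps)
  hence "exp (2 * \<i> * of_real pi * ((1 + \<tau>) / 2)) = - exp (\<i> * of_real pi * \<tau>)"
    by (simp add: exp_add)
  thus ?thesis
    using weierstrass_p_half_period_odd[OF assms, of 1] by (simp add: weierstrass_e2_def)
qed

lemma weierstrass_e3_eq:
  assumes "Im \<tau> > 0"
  shows "weierstrass_e3 \<tau> = - (of_real pi ^ 2 / 3) * level_two_E2 (exp (\<i> * of_real pi * \<tau>))"
proof -
  have "2 * \<i> * of_real pi * (\<tau> / 2) = \<i> * of_real pi * \<tau>" by simp
  thus ?thesis
    using weierstrass_p_half_period_odd[OF assms, of 0]
    by (simp only: weierstrass_e3_def of_int_0 add_0) simp
qed

lemma eisenstein_E2_eq: "Im \<tau> > 0 \<Longrightarrow> eisenstein_E2 \<tau> = 1 - 24 * lambert_series 1 (nome_sq \<tau>)"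
  unfolding eisenstein_E2_def infsum_sigma1[OF norm_nome_sq_less_1] ..

lemma eisenstein_E4_eq: "eisenstein_E4 \<tau> = 1 + 240 * lambert_series 3 (nome_sq \<tau>)"
  by (simp add: eisenstein_E4_def lambert_series_def lambert_coeff_def)

section \<open>The Riccati equations\<close>

lemma level_two_E2_has_derivative:
  assumes "norm x < 1"
  obtains D where "(level_two_E2 has_field_derivative D) (at x)"
    "x * D = 24 * lambert_theta x - 96 * lambert_theta (x ^ 2)"
proof -
  have x2: "norm (x ^ 2) < 1" using assms by (simp add: norm_power power_less_one_iff)
  obtain D1 where D1: "(lambert_series 1 has_field_derivative D1) (at x)" "x * D1 = lambert_theta x"
    using lambert_series_has_derivative[OF assms] .
  obtain D2 where D2: "(lambert_series 1 has_field_derivative D2) (at (x ^ 2))"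
    "x ^ 2 * D2 = lambert_theta (x ^ 2)"
    using lambert_series_has_derivative[OF x2] .
  have "((\<lambda>x. x ^ 2) has_field_derivative 2 * x) (at x)"
    by (auto intro!: derivative_eq_intros)
  from DERIV_chain2[OF D2(1) this]
  have "((\<lambda>x. lambert_series 1 (x ^ 2)) has_field_derivative D2 * (2 * x)) (at x)" .
  hence "(level_two_E2 has_field_derivative 0 + 24 * D1 - 48 * (D2 * (2 * x))) (at x)"
    unfolding level_two_E2_def [abs_def]
    by (intro DERIV_diff DERIV_add DERIV_const DERIV_cmult D1(1))
  moreover have "x * (0 + 24 * D1 - 48 * (D2 * (2 * x))) = 24 * lambert_theta x - 96 * lambert_theta (x ^ 2)"
    unfolding D1(2)[symmetric] D2(2)[symmetric] by (simp add: algebra_simps power2_eq_square)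
  ultimately show ?thesis by (rule that)
qed

lemma has_derivative_via_level_two:
  assumes \<tau>: "Im \<tau> > 0" and y: "\<And>z. Im z > 0 \<Longrightarrow> y z = c * level_two_E2 (h z)"
    and h: "(h has_field_derivative s * h \<tau>) (at \<tau>)" and n: "norm (h \<tau>) < 1"
  shows "(y has_field_derivative c * s * (24 * lambert_theta (h \<tau>) - 96 * lambert_theta (h \<tau> ^ 2))) (at \<tau>)"
proof -
  obtain D where D: "(level_two_E2 has_field_derivative D) (at (h \<tau>))"
    "h \<tau> * D = 24 * lambert_theta (h \<tau>) - 96 * lambert_theta (h \<tau> ^ 2)"
    using level_two_E2_has_derivative[OF n] .
  have "((\<lambda>z. c * level_two_E2 (h z)) has_field_derivative c * (D * (s * h \<tau>))) (at \<tau>)"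
    by (intro DERIV_cmult DERIV_chain2[OF D(1) h])
  also have "c * (D * (s * h \<tau>)) = c * s * (24 * lambert_theta (h \<tau>) - 96 * lambert_theta (h \<tau> ^ 2))"
    unfolding D(2)[symmetric] by (simp add: mult_ac)
  finally show ?thesis
    by (rule has_field_derivative_transform_within_open[of _ _ _ "{z. Im z > 0}"])
       (use \<tau> y in \<open>auto simp: open_halfspace_Im_gt\<close>)
qed

theorem theorem9:
  fixes \<tau> :: complex and y :: "complex \<Rightarrow> complex"
  assumes "Im \<tau> > 0"
    and "y \<in> {weierstrass_e1, weierstrass_e2, weierstrass_e3}"
  shows "(y has_field_derivative
           \<i> / complex_of_real pi *
             (- (y \<tau> ^ 2) + complex_of_real pi ^ 2 / 3 * eisenstein_E2 \<tau> * y \<tau>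
              + 2 / 9 * complex_of_real pi ^ 4 * eisenstein_E4 \<tau>)) (at \<tau>)"
proof -
  let ?p = "\<lambda>\<tau>. exp (\<i> * of_real pi * \<tau>)"
  have odd_algebra: "- (c * p ^ 3 / 9) * (A ^ 2 + E * A - 2 * Q)
      = c / p * (- ((- (p ^ 2 / 3) * A) ^ 2) + p ^ 2 / 3 * E * (- (p ^ 2 / 3) * A) + 2 / 9 * p ^ 4 * Q)"
    if "p \<noteq> 0" for c p A E Q :: complex
    using that by (simp add: field_simps power2_eq_square power3_eq_cube power4_eq_xxxx)
  have even_algebra: "2 * c * p ^ 3 / 9 * (- 2 * A ^ 2 + E * A + Q)
      = c / p * (- ((2 * p ^ 2 / 3 * A) ^ 2) + p ^ 2 / 3 * E * (2 * p ^ 2 / 3 * A) + 2 / 9 * p ^ 4 * Q)"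
    if "p \<noteq> 0" for c p A E Q :: complex
    using that by (simp add: field_simps power2_eq_square power3_eq_cube power4_eq_xxxx)
  \<comment> \<open>\<open>e\<^sub>2\<close> and \<open>e\<^sub>3\<close> differ only in the choice \<open>\<epsilon> = \<plusminus>1\<close> of the square root \<open>x\<close> of \<open>q\<close>\<close>
  have odd: ?thesis
    if y: "\<And>z. Im z > 0 \<Longrightarrow> y z = - (of_real pi ^ 2 / 3) * level_two_E2 (\<epsilon> * ?p z)" and \<epsilon>: "\<epsilon> ^ 2 = 1" for \<epsilon>
  proof -
    define x where "x = \<epsilon> * ?p \<tau>"
    have x2: "x ^ 2 = nome_sq \<tau>" by (simp add: x_def power_mult_distrib \<epsilon> nome_sq_eq_square)
    have "norm (x ^ 2) < 1" using norm_nome_sq_less_1[OF assms(1)] by (simp add: x2)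
    hence n: "norm x < 1" by (simp add: norm_power power_less_one_iff)
    have "((\<lambda>z. \<epsilon> * ?p z) has_field_derivative (\<i> * of_real pi) * (\<epsilon> * ?p \<tau>)) (at \<tau>)"
      by (auto intro!: derivative_eq_intros)
    from has_derivative_via_level_two[OF assms(1) y this] n
    have "(y has_field_derivative - (of_real pi ^ 2 / 3) * (\<i> * of_real pi)
             * (24 * lambert_theta x - 96 * lambert_theta (x ^ 2))) (at \<tau>)"
      by (simp add: x_def)
    also have "- (of_real pi ^ 2 / 3) * (\<i> * of_real pi) * (24 * lambert_theta x - 96 * lambert_theta (x ^ 2))
       = - (\<i> * of_real pi ^ 3 / 9) * (3 * (24 * lambert_theta x - 96 * lambert_theta (x ^ 2)))"
      by (simp add: power2_eq_square power3_eq_cube)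
    also have "\<dots> = - (\<i> * of_real pi ^ 3 / 9) *
        (level_two_E2 x ^ 2 + eisenstein_E2 \<tau> * level_two_E2 x - 2 * eisenstein_E4 \<tau>)"
      unfolding lambert_level_two(2)[OF n] level_two_E2_def
        eisenstein_E2_eq[OF assms(1)] eisenstein_E4_eq x2[symmetric] by (rule refl)
    also have "\<dots> = \<i> / of_real pi * (- (y \<tau> ^ 2) + of_real pi ^ 2 / 3 * eisenstein_E2 \<tau> * y \<tau>
              + 2 / 9 * of_real pi ^ 4 * eisenstein_E4 \<tau>)"
      unfolding y[OF assms(1)] x_def[symmetric] by (rule odd_algebra) simp
    finally show ?thesis .
  qed
  consider "y = weierstrass_e1" | "y = weierstrass_e2" | "y = weierstrass_e3"
    using assms(2) by auto
  thus ?thesis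
  proof cases
    case 1
    define x where "x = nome_sq \<tau>"
    have n: "norm x < 1" using norm_nome_sq_less_1[OF assms(1)] by (simp add: x_def)
    have y: "y z = 2 * of_real pi ^ 2 / 3 * level_two_E2 (nome_sq z)" if "Im z > 0" for z
      using weierstrass_e1_eq[OF that] 1 by simp
    have "(nome_sq has_field_derivative (2 * \<i> * of_real pi) * nome_sq \<tau>) (at \<tau>)"
      unfolding nome_sq_def [abs_def] by (auto intro!: derivative_eq_intros)
    from has_derivative_via_level_two[OF assms(1) y this] n
    have "(y has_field_derivative 2 * of_real pi ^ 2 / 3 * (2 * \<i> * of_real pi)
             * (24 * lambert_theta x - 96 * lambert_theta (x ^ 2))) (at \<tau>)"
      by (simp add: x_def)
    also have "2 * of_real pi ^ 2 / 3 * (2 * \<i> * of_real pi) * (24 * lambert_theta x - 96 * lambert_theta (x ^ 2))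
       = 2 * \<i> * of_real pi ^ 3 / 9 * (6 * (24 * lambert_theta x - 96 * lambert_theta (x ^ 2)))"
      by (simp add: power2_eq_square power3_eq_cube)
    also have "\<dots> = 2 * \<i> * of_real pi ^ 3 / 9 *
        (- 2 * level_two_E2 x ^ 2 + eisenstein_E2 \<tau> * level_two_E2 x + eisenstein_E4 \<tau>)"
      unfolding lambert_level_two(1)[OF n] level_two_E2_def
        eisenstein_E2_eq[OF assms(1)] eisenstein_E4_eq x_def[symmetric] by (rule refl)
    also have "\<dots> = \<i> / of_real pi * (- (y \<tau> ^ 2) + of_real pi ^ 2 / 3 * eisenstein_E2 \<tau> * y \<tau>
              + 2 / 9 * of_real pi ^ 4 * eisenstein_E4 \<tau>)"
      unfolding y[OF assms(1)] x_def[symmetric] by (rule even_algebra) simp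
    finally show ?thesis .
  next
    case 2
    show ?thesis by (rule odd[of "- 1"]) (simp_all add: 2 weierstrass_e2_eq)
  next
    case 3
    show ?thesis by (rule odd[of 1]) (simp_all add: 3 weierstrass_e3_eq)
  qed
qed

end
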